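(* Let $X_1,\ldots,X_n$ and $Y$ be Banach spaces. Then $(\mathcal{L}(\Sigma_{X_1,\ldots,X_n};Y),\|\cdot\|_{Lip})$ is a Banach space isometrically isomorphic to both $\mathcal{L}(X_1,\ldots,X_n;Y)$ and $\mathcal{L}(X_1\hat\otimes_\pi\cdots\hat\otimes_\pi X_n;Y)$.
   Context: Banach spaces are over the same field $\mathbb{R}$ or $\mathbb{C}$. $\Sigma_{X_1,\ldots,X_n}=\{x_1\otimes\cdots\otimes x_n: x_i\in X_i\}\subset X_1\otimes\cdots\otimes X_n$ is the set of decomposable tensors, with the metric $d_\pi(w,z)=\pi(w-z)$, where $\pi(z)=\inf\{\sum_i\|x_1^i\|\cdots\|x_n^i\|: z=\sum_i x_1^i\otimes\cdots\otimes x_n^i\}$ is the projective norm; $X_1\hat\otimes_\pi\cdots\hat\otimes_\pi X_n$ is the completion of $(X_1\otimes\cdots\otimes X_n,\pi)$. A map $f:\Sigma_{X_1,\ldots,X_n}\to Y$ is a $\Sigma$-operator if there is a multilinear mapping $T:X_1\times\cdots\times X_n\to Y$ such that $f=\hat T|_{\Sigma_{X_1,\ldots,X_n}}$, where $\hat T:X_1\otimes\cdots\otimes X_n\to Y$ is the linear map with $\hat T(x_1\otimes\cdots\otimes x_n)=T(x_1,\ldots,x_n)$. $\mathcal{L}(\Sigma_{X_1,\ldots,X_n};Y)$ is the vector space (with pointwise operations) of $\Sigma$-operators that are Lipschitz for $d_\pi$, and $\|f\|_{Lip}$ is the least Lipschitz constant of $f$. $\mathcal{L}(X_1,\ldots,X_n;Y)$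 is the Banach space of bounded multilinear mappings $X_1\times\cdots\times X_n\to Y$ with norm $\|T\|=\sup\{\|T(x_1,\ldots,x_n)\|:\|x_i\|\le1\}$, and $\mathcal{L}(X_1\hat\otimes_\pi\cdots\hat\otimes_\pi X_n;Y)$ is the Banach space of bounded linear operators with the operator norm. *)

theory Defs
  imports Complex_Main "HOL-Algebra.Module" "HOL-Library.Poly_Mapping"
begin

(* The scalars are an arbitrary type of sort {real_normed_field, banach}. Both real and complex
   have this sort, and by the Gelfand-Mazur theorem every other instance is isometrically
   isomorphic to one of them.

   A Banach space is a HOL-Algebra module with a norm on its carrier, so that a family of
   different spaces X 1, ..., X n can be written as one function X: the spaces may have arbitrary,
   unrelated carriers and operations inside the common element type, which can be taken to be a
   sum of n given types. The ring fields mult and one of the record are not used. *)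

definition scalar_ring :: "'k::field ring" where
  "scalar_ring = \<lparr>carrier = UNIV, mult = (*), one = 1, zero = 0, add = (+)\<rparr>"

record ('k, 'v) normed_module = "('k, 'v) module" +
  vnorm :: "'v \<Rightarrow> real"  (\<open>\<parallel>_\<parallel>\<index>\<close>)

locale normed_space = Module.module "scalar_ring :: 'k::{real_normed_field, banach} ring" V
  for V :: "('k::{real_normed_field, banach}, 'v) normed_module" (structure) +
  assumes vnorm_eq_0_iff: "x \<in> carrier V \<Longrightarrow> \<parallel>x\<parallel> = 0 \<longleftrightarrow> x = \<zero>"
    and vnorm_smult: "x \<in> carrier V \<Longrightarrow> \<parallel>c \<odot> x\<parallel> = norm c * \<parallel>x\<parallel>"
    and vnorm_triangle: "x \<in> carrier V \<Longrightarrow> y \<in> carrier V \<Longrightarrow> \<parallel>x \<oplus> y\<parallel> \<le> \<parallel>x\<parallel> + \<parallel>y\<parallel>"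

definition cauchy_seqs :: "('k, 'v) normed_module \<Rightarrow> (nat \<Rightarrow> 'v) set" where
  "cauchy_seqs V = {s. (\<forall>m. s m \<in> carrier V) \<and>
     (\<forall>e>0. \<exists>N. \<forall>p\<ge>N. \<forall>q\<ge>N. \<parallel>s p \<ominus>\<^bsub>V\<^esub> s q\<parallel>\<^bsub>V\<^esub> < e)}"

locale banach_space = normed_space +
  assumes complete: "s \<in> cauchy_seqs V \<Longrightarrow> \<exists>x\<in>carrier V. (\<lambda>m. \<parallel>s m \<ominus> x\<parallel>) \<longlonglongrightarrow> 0"

section \<open>Spaces of maps\<close>

(* Maps are extensional (undefined outside their domain), so that equality of maps is equality
   on the domain. *)

definition pointwise ::
  "'d set \<Rightarrow> ('k, 'w) normed_module \<Rightarrow> ('d \<Rightarrow> 'w) set \<Rightarrow> (('d \<Rightarrow> 'w) \<Rightarrow> real) \<Rightarrow>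
    ('k, 'd \<Rightarrow> 'w) normed_module" where
  "pointwise D W F N =
    \<lparr>carrier = F, mult = undefined, one = undefined,
     zero = (\<lambda>x\<in>D. \<zero>\<^bsub>W\<^esub>),
     add = (\<lambda>f g. \<lambda>x\<in>D. f x \<oplus>\<^bsub>W\<^esub> g x),
     smult = (\<lambda>c f. \<lambda>x\<in>D. c \<odot>\<^bsub>W\<^esub> f x),
     vnorm = N\<rparr>"

definition linear_maps ::
  "('k, 'v) normed_module \<Rightarrow> ('k, 'w) normed_module \<Rightarrow> ('v \<Rightarrow> 'w) set" where
  "linear_maps V W = {S \<in> carrier V \<rightarrow>\<^sub>E carrier W.
     (\<forall>x\<in>carrier V. \<forall>y\<in>carrier V. S (x \<oplus>\<^bsub>V\<^esub> y) = S x \<oplus>\<^bsub>W\<^esub> S y) \<and>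
     (\<forall>c. \<forall>x\<in>carrier V. S (c \<odot>\<^bsub>V\<^esub> x) = c \<odot>\<^bsub>W\<^esub> S x)}"

definition bounded_linear_space ::
  "('k, 'v) normed_module \<Rightarrow> ('k, 'w) normed_module \<Rightarrow> ('k, 'v \<Rightarrow> 'w) normed_module" where
  "bounded_linear_space V W =
     pointwise (carrier V) W
       {S \<in> linear_maps V W. \<exists>C. \<forall>x\<in>carrier V. \<parallel>S x\<parallel>\<^bsub>W\<^esub> \<le> C * \<parallel>x\<parallel>\<^bsub>V\<^esub>}
       (\<lambda>S. Sup {\<parallel>S x\<parallel>\<^bsub>W\<^esub> | x. x \<in> carrier V \<and> \<parallel>x\<parallel>\<^bsub>V\<^esub> \<le> 1})"

definition isometrically_isomorphic ::
  "('k, 'v) normed_module \<Rightarrow> ('k, 'w) normed_module \<Rightarrow> bool" where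
  "isometrically_isomorphic V W \<longleftrightarrow>
     (\<exists>\<phi>\<in>linear_maps V W. bij_betw \<phi> (carrier V) (carrier W) \<and>
        (\<forall>x\<in>carrier V. \<parallel>\<phi> x\<parallel>\<^bsub>W\<^esub> = \<parallel>x\<parallel>\<^bsub>V\<^esub>))"

definition tuples :: "nat \<Rightarrow> (nat \<Rightarrow> ('k, 'a) normed_module) \<Rightarrow> (nat \<Rightarrow> 'a) set" where
  "tuples n X = (\<Pi>\<^sub>E i\<in>{1..n}. carrier (X i))"

definition multilinear_maps ::
  "nat \<Rightarrow> (nat \<Rightarrow> ('k, 'a) normed_module) \<Rightarrow> ('k, 'w) normed_module \<Rightarrow> ((nat \<Rightarrow> 'a) \<Rightarrow> 'w) set"
  where
  "multilinear_maps n X W = {T \<in> tuples n X \<rightarrow>\<^sub>E carrier W.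
     \<forall>x\<in>tuples n X. \<forall>i\<in>{1..n}. (\<lambda>a\<in>carrier (X i). T (x(i := a))) \<in> linear_maps (X i) W}"

definition bounded_multilinear_space ::
  "nat \<Rightarrow> (nat \<Rightarrow> ('k, 'a) normed_module) \<Rightarrow> ('k, 'w) normed_module \<Rightarrow>
    ('k, (nat \<Rightarrow> 'a) \<Rightarrow> 'w) normed_module" where
  "bounded_multilinear_space n X W =
     pointwise (tuples n X) W
       {T \<in> multilinear_maps n X W.
          \<exists>C. \<forall>x\<in>tuples n X. \<parallel>T x\<parallel>\<^bsub>W\<^esub> \<le> C * (\<Prod>i=1..n. \<parallel>x i\<parallel>\<^bsub>X i\<^esub>)}
       (\<lambda>T. Sup {\<parallel>T x\<parallel>\<^bsub>W\<^esub> | x. x \<in> tuples n X \<and> (\<forall>i\<in>{1..n}. \<parallel>x i\<parallel>\<^bsub>X i\<^esub> \<le> 1)})"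

section \<open>The projective tensor product\<close>

(* The algebraic tensor product is the free vector space on the set of tuples (finitely supported
   scalar functions on it) modulo the subspace spanned by the multilinearity relations. *)

definition free_scale :: "'k::field \<Rightarrow> ('b \<Rightarrow>\<^sub>0 'k) \<Rightarrow> ('b \<Rightarrow>\<^sub>0 'k)" where
  "free_scale c p = Poly_Mapping.map ((*) c) p"

definition multilinearity_relations ::
  "nat \<Rightarrow> (nat \<Rightarrow> ('k::field, 'a) normed_module) \<Rightarrow> ((nat \<Rightarrow> 'a) \<Rightarrow>\<^sub>0 'k) set" where
  "multilinearity_relations n X =
     {Poly_Mapping.single (x(i := a \<oplus>\<^bsub>X i\<^esub> b)) 1
        - Poly_Mapping.single (x(i := a)) 1 - Poly_Mapping.single (x(i := b)) 1 | x i a b.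
        x \<in> tuples n X \<and> i \<in> {1..n} \<and> a \<in> carrier (X i) \<and> b \<in> carrier (X i)} \<union>
     {Poly_Mapping.single (x(i := c \<odot>\<^bsub>X i\<^esub> a)) 1 - Poly_Mapping.single (x(i := a)) c | x i c a.
        x \<in> tuples n X \<and> i \<in> {1..n} \<and> a \<in> carrier (X i)}"

definition free_carrier ::
  "nat \<Rightarrow> (nat \<Rightarrow> ('k::field, 'a) normed_module) \<Rightarrow> ((nat \<Rightarrow> 'a) \<Rightarrow>\<^sub>0 'k) set" where
  "free_carrier n X = {p. Poly_Mapping.keys p \<subseteq> tuples n X}"

definition tensor_rel ::
  "nat \<Rightarrow> (nat \<Rightarrow> ('k::field, 'a) normed_module) \<Rightarrow> ((nat \<Rightarrow> 'a) \<Rightarrow>\<^sub>0 'k) rel" where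
  "tensor_rel n X = {(p, q). p \<in> free_carrier n X \<and> q \<in> free_carrier n X \<and>
     p - q \<in> Modules.module.span free_scale (multilinearity_relations n X)}"

definition tensor_product ::
  "nat \<Rightarrow> (nat \<Rightarrow> ('k::field, 'a) normed_module) \<Rightarrow> ('k, ((nat \<Rightarrow> 'a) \<Rightarrow>\<^sub>0 'k) set) module" where
  "tensor_product n X =
    \<lparr>carrier = free_carrier n X // tensor_rel n X, mult = undefined, one = undefined,
     zero = tensor_rel n X `` {0},
     add = (\<lambda>A B. \<Union>p\<in>A. \<Union>q\<in>B. tensor_rel n X `` {p + q}),
     smult = (\<lambda>c A. \<Union>p\<in>A. tensor_rel n X `` {free_scale c p})\<rparr>"

(* x 1 \<otimes> ... \<otimes> x n *)
definition elementary_tensor ::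
  "nat \<Rightarrow> (nat \<Rightarrow> ('k::field, 'a) normed_module) \<Rightarrow> (nat \<Rightarrow> 'a) \<Rightarrow> ((nat \<Rightarrow> 'a) \<Rightarrow>\<^sub>0 'k) set" where
  "elementary_tensor n X x = tensor_rel n X `` {Poly_Mapping.single x 1}"

definition projective_norm ::
  "nat \<Rightarrow> (nat \<Rightarrow> ('k::field, 'a) normed_module) \<Rightarrow> ((nat \<Rightarrow> 'a) \<Rightarrow>\<^sub>0 'k) set \<Rightarrow> real" where
  "projective_norm n X z =
     Inf {(\<Sum>j<m. \<Prod>i=1..n. \<parallel>x j i\<parallel>\<^bsub>X i\<^esub>) | (m::nat) x.
        (\<forall>j<m. x j \<in> tuples n X) \<and>
        z = (\<Oplus>\<^bsub>tensor_product n X\<^esub> j\<in>{..<m}. elementary_tensor n X (x j))}"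

definition projective_tensor_product ::
  "nat \<Rightarrow> (nat \<Rightarrow> ('k::field, 'a) normed_module) \<Rightarrow>
    ('k, ((nat \<Rightarrow> 'a) \<Rightarrow>\<^sub>0 'k) set) normed_module" where
  "projective_tensor_product n X =
     module.extend (tensor_product n X) \<lparr>vnorm = projective_norm n X\<rparr>"

section \<open>Completion\<close>

definition completion_rel :: "('k, 'v) normed_module \<Rightarrow> (nat \<Rightarrow> 'v) rel" where
  "completion_rel V = {(s, t). s \<in> cauchy_seqs V \<and> t \<in> cauchy_seqs V \<and>
     (\<lambda>m. \<parallel>s m \<ominus>\<^bsub>V\<^esub> t m\<parallel>\<^bsub>V\<^esub>) \<longlonglongrightarrow> 0}"

definition completion ::
  "('k, 'v) normed_module \<Rightarrow> ('k, (nat \<Rightarrow> 'v) set) normed_module" where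
  "completion V =
    \<lparr>carrier = cauchy_seqs V // completion_rel V, mult = undefined, one = undefined,
     zero = completion_rel V `` {\<lambda>_. \<zero>\<^bsub>V\<^esub>},
     add = (\<lambda>A B. \<Union>s\<in>A. \<Union>t\<in>B. completion_rel V `` {\<lambda>m. s m \<oplus>\<^bsub>V\<^esub> t m}),
     smult = (\<lambda>c A. \<Union>s\<in>A. completion_rel V `` {\<lambda>m. c \<odot>\<^bsub>V\<^esub> s m}),
     vnorm = (\<lambda>A. THE r. \<forall>s\<in>A. (\<lambda>m. \<parallel>s m\<parallel>\<^bsub>V\<^esub>) \<longlonglongrightarrow> r)\<rparr>"

section \<open>Lipschitz Sigma-operators\<close>

definition decomposable_tensors ::
  "nat \<Rightarrow> (nat \<Rightarrow> ('k::field, 'a) normed_module) \<Rightarrow> ((nat \<Rightarrow> 'a) \<Rightarrow>\<^sub>0 'k) set set" where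
  "decomposable_tensors n X = elementary_tensor n X ` tuples n X"

definition d_pi ::
  "nat \<Rightarrow> (nat \<Rightarrow> ('k::field, 'a) normed_module) \<Rightarrow>
    ((nat \<Rightarrow> 'a) \<Rightarrow>\<^sub>0 'k) set \<Rightarrow> ((nat \<Rightarrow> 'a) \<Rightarrow>\<^sub>0 'k) set \<Rightarrow> real" where
  "d_pi n X w z = projective_norm n X (w \<ominus>\<^bsub>tensor_product n X\<^esub> z)"

definition sigma_operators ::
  "nat \<Rightarrow> (nat \<Rightarrow> ('k::field, 'a) normed_module) \<Rightarrow> ('k, 'w) normed_module \<Rightarrow>
    (((nat \<Rightarrow> 'a) \<Rightarrow>\<^sub>0 'k) set \<Rightarrow> 'w) set" where
  "sigma_operators n X Y =
     {f. \<exists>T\<in>multilinear_maps n X Y. \<exists>S\<in>linear_maps (projective_tensor_product n X) Y.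
           (\<forall>x\<in>tuples n X. S (elementary_tensor n X x) = T x) \<and>
           f = restrict S (decomposable_tensors n X)}"

definition lipschitz_constants ::
  "nat \<Rightarrow> (nat \<Rightarrow> ('k::field, 'a) normed_module) \<Rightarrow> ('k, 'w) normed_module \<Rightarrow>
    (((nat \<Rightarrow> 'a) \<Rightarrow>\<^sub>0 'k) set \<Rightarrow> 'w) \<Rightarrow> real set" where
  "lipschitz_constants n X Y f = {L. 0 \<le> L \<and>
     (\<forall>w\<in>decomposable_tensors n X. \<forall>z\<in>decomposable_tensors n X.
        \<parallel>f w \<ominus>\<^bsub>Y\<^esub> f z\<parallel>\<^bsub>Y\<^esub> \<le> L * d_pi n X w z)}"

definition lipschitz_sigma_space ::
  "nat \<Rightarrow> (nat \<Rightarrow> ('k::field, 'a) normed_module) \<Rightarrow> ('k, 'w) normed_module \<Rightarrow>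
    ('k, ((nat \<Rightarrow> 'a) \<Rightarrow>\<^sub>0 'k) set \<Rightarrow> 'w) normed_module" where
  "lipschitz_sigma_space n X Y =
     pointwise (decomposable_tensors n X) Y
       {f \<in> sigma_operators n X Y. lipschitz_constants n X Y f \<noteq> {}}
       (\<lambda>f. Inf (lipschitz_constants n X Y f))"

end

(* A Sigma-operator f, the multilinear map T x = f (x 1 \<otimes> ... \<otimes> x n) and its linearization S
   determine each other. A constant C satisfies norm (T x) \<le> C * norm (x 1) * ... * norm (x n) for
   all x iff norm (S z) \<le> C * \<pi> z for all z (estimate each summand of a representation of z) iff f
   is C-Lipschitz (apply the bound on S to w - z; conversely compare x 1 \<otimes> ... \<otimes> x n with 0, which
   is decomposable). Each of the norms is the least such constant, so the bijections are isometric,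
   and completeness is inherited from the bounded multilinear maps. That \<pi> z = 0 implies z = 0 is
   never used: the completion of a seminormed space already identifies points at distance 0. *)

theory Submission
  imports Defs
begin

section \<open>Seminormed spaces\<close>

text \<open>Every comparison of norms is an equality of sets of admissible constants,
  \<open>bound_constants\<close> or \<open>lipschitz_constants\<close>. One such equality yields two
  facts at once: boundedness is nonemptiness of the set, and the norm is its infimum. The suprema
  over unit balls in the definitions are therefore turned into infima by rescaling vectors before
  two spaces are compared.

  Completeness of the space of \<Sigma>-operators is not attacked directly: decomposable tensors
  need not form a vector space, and a pointwise limit of \<Sigma>-operators would still have to be
  extended linearly to the whole tensor product. Multilinearity, in contrast, passes to pointwise
  limits at once.

  The hypothesis \<open>1 \<le> n\<close> enters because the representations in the infimum defining
  \<pi> carry no scalar coefficients: a scalar has to be absorbed into a factor, here always the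
  first. The same device with the scalar 0 makes the zero tensor decomposable.\<close>

lemma cring_scalar_ring: "cring (scalar_ring :: 'k::field ring)"
proof (rule cringI)
  show "abelian_group (scalar_ring :: 'k ring)"
    by (rule abelian_groupI) (auto simp: scalar_ring_def add_ac intro: exI[of _ "- x" for x])
  show "comm_monoid (scalar_ring :: 'k ring)"
    by (rule comm_monoidI) (auto simp: scalar_ring_def mult_ac)
qed (auto simp: scalar_ring_def algebra_simps)

lemma scalar_ring_simps [simp]:
  "carrier scalar_ring = UNIV" "x \<otimes>\<^bsub>scalar_ring\<^esub> y = x * y" "\<one>\<^bsub>scalar_ring\<^esub> = 1"
  "\<zero>\<^bsub>scalar_ring\<^esub> = 0" "x \<oplus>\<^bsub>scalar_ring\<^esub> y = x + y"
  by (auto simp: scalar_ring_def)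

lemma scalar_ring_uminus [simp]: "\<ominus>\<^bsub>scalar_ring\<^esub> x = - (x :: 'k::field)"
proof -
  interpret cring "scalar_ring :: 'k ring" by (rule cring_scalar_ring)
  show ?thesis using add.inv_equality[of "- x" x] by simp
qed

text \<open>Additive inverses are absent from the premises: \<open>(-1) \<odot> x\<close> serves as
  the negative of \<open>x\<close>, by \<open>l_distr\<close>, \<open>one\<close> and
  \<open>null\<close>. This suits the later instances (function spaces, isometric images, quotients,
  completions), where scalar multiples are given by formulas and negatives are not.\<close>

lemma scalar_moduleI:
  fixes V :: "('k::field, 'v, 'm) module_scheme"
  assumes add: "\<And>x y. x \<in> carrier V \<Longrightarrow> y \<in> carrier V \<Longrightarrow> x \<oplus>\<^bsub>V\<^esub> y \<in> carrier V"
    and zero: "\<zero>\<^bsub>V\<^esub> \<in> carrier V"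
    and smult: "\<And>c x. x \<in> carrier V \<Longrightarrow> c \<odot>\<^bsub>V\<^esub> x \<in> carrier V"
    and assoc: "\<And>x y z. x \<in> carrier V \<Longrightarrow> y \<in> carrier V \<Longrightarrow> z \<in> carrier V \<Longrightarrow>
      (x \<oplus>\<^bsub>V\<^esub> y) \<oplus>\<^bsub>V\<^esub> z = x \<oplus>\<^bsub>V\<^esub> (y \<oplus>\<^bsub>V\<^esub> z)"
    and comm: "\<And>x y. x \<in> carrier V \<Longrightarrow> y \<in> carrier V \<Longrightarrow> x \<oplus>\<^bsub>V\<^esub> y = y \<oplus>\<^bsub>V\<^esub> x"
    and l_zero: "\<And>x. x \<in> carrier V \<Longrightarrow> \<zero>\<^bsub>V\<^esub> \<oplus>\<^bsub>V\<^esub> x = x"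
    and l_distr: "\<And>a b x. x \<in> carrier V \<Longrightarrow> (a + b) \<odot>\<^bsub>V\<^esub> x = a \<odot>\<^bsub>V\<^esub> x \<oplus>\<^bsub>V\<^esub> b \<odot>\<^bsub>V\<^esub> x"
    and r_distr: "\<And>a x y. x \<in> carrier V \<Longrightarrow> y \<in> carrier V \<Longrightarrow>
      a \<odot>\<^bsub>V\<^esub> (x \<oplus>\<^bsub>V\<^esub> y) = a \<odot>\<^bsub>V\<^esub> x \<oplus>\<^bsub>V\<^esub> a \<odot>\<^bsub>V\<^esub> y"
    and smult_assoc: "\<And>a b x. x \<in> carrier V \<Longrightarrow> (a * b) \<odot>\<^bsub>V\<^esub> x = a \<odot>\<^bsub>V\<^esub> (b \<odot>\<^bsub>V\<^esub> x)"
    and one: "\<And>x. x \<in> carrier V \<Longrightarrow> 1 \<odot>\<^bsub>V\<^esub> x = x"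
    and null: "\<And>x. x \<in> carrier V \<Longrightarrow> 0 \<odot>\<^bsub>V\<^esub> x = \<zero>\<^bsub>V\<^esub>"
  shows "Module.module scalar_ring V"
proof (rule moduleI)
  show "abelian_group V"
  proof (rule abelian_groupI)
    fix x assume x: "x \<in> carrier V"
    have "(-1) \<odot>\<^bsub>V\<^esub> x \<oplus>\<^bsub>V\<^esub> x = (-1 + 1) \<odot>\<^bsub>V\<^esub> x"
      unfolding l_distr[OF x] by (simp add: one x)
    then show "\<exists>y\<in>carrier V. y \<oplus>\<^bsub>V\<^esub> x = \<zero>\<^bsub>V\<^esub>"
      using smult[OF x] null[OF x] by (intro bexI[of _ "(-1) \<odot>\<^bsub>V\<^esub> x"]) simp_all
  qed (fact add zero assoc l_zero comm)+
qed (simp_all add: cring_scalar_ring smult l_distr r_distr smult_assoc one)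

text \<open>The tensor product with \<pi> and its completion are handled through these axioms; the
  sublocale below makes the same calculus available in every \<open>normed_space\<close>.\<close>

locale seminormed_space = Module.module "scalar_ring :: 'k::{real_normed_field, banach} ring" V
  for V :: "('k::{real_normed_field, banach}, 'v) normed_module" (structure) +
  assumes vnorm_smult: "x \<in> carrier V \<Longrightarrow> \<parallel>c \<odot> x\<parallel> = norm c * \<parallel>x\<parallel>"
    and vnorm_triangle: "x \<in> carrier V \<Longrightarrow> y \<in> carrier V \<Longrightarrow> \<parallel>x \<oplus> y\<parallel> \<le> \<parallel>x\<parallel> + \<parallel>y\<parallel>"

sublocale normed_space \<subseteq> seminormed_space
  by unfold_locales (auto intro: vnorm_smult vnorm_triangle)

section \<open>Vector and norm calculus\<close>

context seminormed_space
begin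

lemma smult_closed' [simp, intro]: "x \<in> carrier V \<Longrightarrow> c \<odot> x \<in> carrier V"
  using smult_closed by simp

lemma smult_add_left: "x \<in> carrier V \<Longrightarrow> (a + b) \<odot> x = a \<odot> x \<oplus> b \<odot> x"
  using smult_l_distr[of a b x] by simp

lemma smult_add_right: "x \<in> carrier V \<Longrightarrow> y \<in> carrier V \<Longrightarrow> a \<odot> (x \<oplus> y) = a \<odot> x \<oplus> a \<odot> y"
  using smult_r_distr[of a x y] by simp

lemma smult_smult: "x \<in> carrier V \<Longrightarrow> a \<odot> (b \<odot> x) = (a * b) \<odot> x"
  using smult_assoc1[of a b x] by simp

lemma smult_1 [simp]: "x \<in> carrier V \<Longrightarrow> 1 \<odot> x = x"
  using smult_one[of x] by simp

lemma smult_0 [simp]: "x \<in> carrier V \<Longrightarrow> 0 \<odot> x = \<zero>"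
  using smult_l_null[of x] by simp

lemma smult_zero [simp]: "c \<odot> \<zero> = \<zero>"
  using smult_r_null[of c] by simp

lemma uminus_eq_smult: "x \<in> carrier V \<Longrightarrow> \<ominus> x = (-1) \<odot> x"
  using smult_l_minus[of 1 x] by simp

lemma minus_eq_smult: "y \<in> carrier V \<Longrightarrow> x \<ominus> y = x \<oplus> (-1) \<odot> y"
  by (simp add: a_minus_def uminus_eq_smult)

lemma minus_self [simp]: "x \<in> carrier V \<Longrightarrow> x \<ominus> x = \<zero>"
  by (simp add: a_minus_def M.r_neg)

lemma minus_zero [simp]: "x \<in> carrier V \<Longrightarrow> x \<ominus> \<zero> = x"
  by (simp add: minus_eq_smult)

lemma smult_minus: "x \<in> carrier V \<Longrightarrow> y \<in> carrier V \<Longrightarrow> c \<odot> x \<ominus> c \<odot> y = c \<odot> (x \<ominus> y)"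
  by (simp add: minus_eq_smult smult_add_right smult_smult)

lemma add_minus_add:
  assumes "x \<in> carrier V" "y \<in> carrier V" "a \<in> carrier V" "b \<in> carrier V"
  shows "(x \<oplus> y) \<ominus> (a \<oplus> b) = (x \<ominus> a) \<oplus> (y \<ominus> b)"
  using assms by (simp add: minus_eq_smult smult_add_right M.a_ac)

lemma minus_telescope:
  assumes x: "x \<in> carrier V" and y: "y \<in> carrier V" and z: "z \<in> carrier V"
  shows "x \<ominus> z = (x \<ominus> y) \<oplus> (y \<ominus> z)"
proof -
  have "(x \<ominus> y) \<oplus> (y \<ominus> z) = x \<oplus> ((\<ominus> y \<oplus> y) \<oplus> \<ominus> z)"
    using assms by (simp add: a_minus_def M.a_assoc)
  then show ?thesis using assms by (simp add: M.l_neg a_minus_def)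
qed

lemma minus_add_cancel: "x \<in> carrier V \<Longrightarrow> y \<in> carrier V \<Longrightarrow> (x \<ominus> y) \<oplus> y = x"
  by (simp add: a_minus_def M.a_assoc M.l_neg)

lemma vnorm_zero [simp]: "\<parallel>\<zero>\<parallel> = 0"
  using vnorm_smult[of \<zero> 0] by simp

lemma vnorm_minus_commute:
  assumes "x \<in> carrier V" "y \<in> carrier V"
  shows "\<parallel>x \<ominus> y\<parallel> = \<parallel>y \<ominus> x\<parallel>"
proof -
  have "x \<ominus> y = (-1) \<odot> (y \<ominus> x)"
    using assms by (simp add: minus_eq_smult smult_add_right smult_smult M.a_comm)
  then show ?thesis using assms by (simp add: vnorm_smult)
qed

text \<open>Nonnegativity is not among the axioms; it comes from \<open>0 = \<parallel>x \<ominus>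
  x\<parallel> \<le> \<parallel>x\<parallel> + \<parallel>(-1) \<odot> x\<parallel> = 2 *
  \<parallel>x\<parallel>\<close>.\<close>

lemma vnorm_nonneg [simp]: "x \<in> carrier V \<Longrightarrow> 0 \<le> \<parallel>x\<parallel>"
  using vnorm_triangle[of x "(-1) \<odot> x"]
  by (simp add: vnorm_smult flip: minus_eq_smult)

lemma vnorm_minus_triangle:
  assumes "x \<in> carrier V" "y \<in> carrier V" "z \<in> carrier V"
  shows "\<parallel>x \<ominus> z\<parallel> \<le> \<parallel>x \<ominus> y\<parallel> + \<parallel>y \<ominus> z\<parallel>"
  using vnorm_triangle[of "x \<ominus> y" "y \<ominus> z"] minus_telescope[of x y z] assms by simp

lemma vnorm_diff_bound:
  assumes "x \<in> carrier V" "y \<in> carrier V"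
  shows "\<bar>\<parallel>x\<parallel> - \<parallel>y\<parallel>\<bar> \<le> \<parallel>x \<ominus> y\<parallel>"
proof -
  have "\<parallel>x\<parallel> \<le> \<parallel>x \<ominus> y\<parallel> + \<parallel>y\<parallel>" "\<parallel>y\<parallel> \<le> \<parallel>y \<ominus> x\<parallel> + \<parallel>x\<parallel>"
    using vnorm_minus_triangle[of x y \<zero>] vnorm_minus_triangle[of y x \<zero>] assms by simp_all
  then show ?thesis using assms by (simp add: vnorm_minus_commute[of y x])
qed

end

text \<open>A relation rather than a function, as limits for a seminorm need not be unique.
  Membership of all points in the carrier is included because the laws for \<open>\<ominus>\<close>
  and the norm hold only there.\<close>

definition limit_of :: "('k, 'v) normed_module \<Rightarrow> (nat \<Rightarrow> 'v) \<Rightarrow> 'v \<Rightarrow> bool" where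
  "limit_of V s x \<longleftrightarrow> (\<forall>m. s m \<in> carrier V) \<and> x \<in> carrier V \<and>
     (\<lambda>m. \<parallel>s m \<ominus>\<^bsub>V\<^esub> x\<parallel>\<^bsub>V\<^esub>) \<longlonglongrightarrow> 0"

lemma cauchy_seqs_closed: "s \<in> cauchy_seqs V \<Longrightarrow> s m \<in> carrier V"
  by (simp add: cauchy_seqs_def)

context seminormed_space
begin

lemma limit_of_const: "x \<in> carrier V \<Longrightarrow> limit_of V (\<lambda>_. x) x"
  by (simp add: limit_of_def)

lemma limit_of_add:
  assumes "limit_of V s x" "limit_of V t y"
  shows "limit_of V (\<lambda>m. s m \<oplus> t m) (x \<oplus> y)"
proof -
  have "(\<lambda>m. \<parallel>(s m \<oplus> t m) \<ominus> (x \<oplus> y)\<parallel>) \<longlonglongrightarrow> 0"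
  proof (rule tendsto_sandwich[OF _ _ tendsto_const])
    show "(\<lambda>m. \<parallel>s m \<ominus> x\<parallel> + \<parallel>t m \<ominus> y\<parallel>) \<longlonglongrightarrow> 0"
      using assms by (auto simp: limit_of_def intro: tendsto_add_zero)
  qed (use assms in \<open>auto simp: limit_of_def add_minus_add intro!: always_eventually vnorm_triangle\<close>)
  then show ?thesis using assms by (simp add: limit_of_def)
qed

lemma limit_of_smult: "limit_of V s x \<Longrightarrow> limit_of V (\<lambda>m. c \<odot> s m) (c \<odot> x)"
  by (auto simp: limit_of_def smult_minus vnorm_smult intro: tendsto_mult_right_zero)

lemma limit_of_minus:
  assumes "limit_of V s x" "limit_of V t y"
  shows "limit_of V (\<lambda>m. s m \<ominus> t m) (x \<ominus> y)"
proof -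
  have "s m \<ominus> t m = s m \<oplus> (-1) \<odot> t m" for m
    using assms by (simp add: limit_of_def minus_eq_smult)
  then show ?thesis
    using limit_of_add[OF assms(1) limit_of_smult[OF assms(2), of "-1"]] assms
    by (simp add: limit_of_def minus_eq_smult)
qed

lemma limit_of_norm: 
  assumes "limit_of V s x"
  shows "(\<lambda>m. \<parallel>s m\<parallel>) \<longlonglongrightarrow> \<parallel>x\<parallel>"
proof (rule LIM_zero_cancel, rule tendsto_rabs_zero_cancel, rule tendsto_sandwich[OF _ _ tendsto_const])
  show "\<forall>\<^sub>F m in sequentially. \<bar>\<parallel>s m\<parallel> - \<parallel>x\<parallel>\<bar> \<le> \<parallel>s m \<ominus> x\<parallel>"
    using assms by (auto simp: limit_of_def vnorm_diff_bound)
qed (use assms in \<open>auto simp: limit_of_def\<close>)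

lemma cauchy_seqsI:
  assumes "\<And>m. s m \<in> carrier V" "\<And>e. e > 0 \<Longrightarrow> \<exists>N. \<forall>p\<ge>N. \<forall>q\<ge>N. \<parallel>s p \<ominus> s q\<parallel> < e"
  shows "s \<in> cauchy_seqs V"
  using assms by (simp add: cauchy_seqs_def)

lemma cauchy_norm_convergent:
  assumes "s \<in> cauchy_seqs V"
  shows "convergent (\<lambda>m. \<parallel>s m\<parallel>)"
proof (rule Cauchy_convergent, rule metric_CauchyI)
  fix e :: real assume "e > 0"
  then obtain N where "\<forall>p\<ge>N. \<forall>q\<ge>N. \<parallel>s p \<ominus> s q\<parallel> < e"
    using assms by (auto simp: cauchy_seqs_def)
  then show "\<exists>N. \<forall>p\<ge>N. \<forall>q\<ge>N. dist \<parallel>s p\<parallel> \<parallel>s q\<parallel> < e"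
    using assms
    by (auto simp: cauchy_seqs_def dist_real_def intro!: exI[of _ N] le_less_trans[OF vnorm_diff_bound])
qed

end

context normed_space
begin

lemma limit_of_unique:
  assumes "limit_of V s x" "limit_of V s y"
  shows "x = y"
proof -
  have xy: "x \<in> carrier V" "y \<in> carrier V" using assms by (auto simp: limit_of_def)
  \<comment> \<open>The norms of \<open>s m \<ominus> s m\<close> are constantly 0 and also converge
    to the norm of \<open>x \<ominus> y\<close>.\<close>
  have "\<parallel>x \<ominus> y\<parallel> = 0"
    using limit_of_norm[OF limit_of_minus[OF assms]] assms
    by (simp add: limit_of_def LIMSEQ_const_iff)
  then show ?thesis using vnorm_eq_0_iff[of "x \<ominus> y"] minus_add_cancel[of x y] xy by simp
qed

end

lemma (in banach_space) cauchy_limit: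
  "s \<in> cauchy_seqs V \<Longrightarrow> \<exists>x. limit_of V s x"
  using complete[of s] by (auto simp: limit_of_def cauchy_seqs_def)

section \<open>Spaces of maps bounded by a weight\<close>

lemma pointwise_simps [simp]:
  "carrier (pointwise D W F N) = F"
  "\<zero>\<^bsub>pointwise D W F N\<^esub> = (\<lambda>x\<in>D. \<zero>\<^bsub>W\<^esub>)"
  "f \<oplus>\<^bsub>pointwise D W F N\<^esub> g = (\<lambda>x\<in>D. f x \<oplus>\<^bsub>W\<^esub> g x)"
  "c \<odot>\<^bsub>pointwise D W F N\<^esub> f = (\<lambda>x\<in>D. c \<odot>\<^bsub>W\<^esub> f x)"
  "vnorm (pointwise D W F N) = N"
  by (simp_all add: pointwise_def)

text \<open>With \<open>w\<close> the norm these are the bounds of a linear map, with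
  \<open>w\<close> the product of the norms those of a multilinear map. The condition
  \<open>0 \<le> C\<close> matters when all weights vanish: for the zero map every real number would
  otherwise qualify, and the infimum would be meaningless.\<close>

definition bound_constants ::
  "'d set \<Rightarrow> ('d \<Rightarrow> real) \<Rightarrow> ('k, 'w) normed_module \<Rightarrow> ('d \<Rightarrow> 'w) \<Rightarrow> real set" where
  "bound_constants D w W f = {C. 0 \<le> C \<and> (\<forall>x\<in>D. \<parallel>f x\<parallel>\<^bsub>W\<^esub> \<le> C * w x)}"

lemma bound_constantsD:
  "C \<in> bound_constants D w W f \<Longrightarrow> x \<in> D \<Longrightarrow> \<parallel>f x\<parallel>\<^bsub>W\<^esub> \<le> C * w x"
  by (simp add: bound_constants_def)

lemma bound_constants_bdd_below: "bdd_below (bound_constants D w W f)"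
  by (auto simp: bound_constants_def bdd_below_def)

lemma Inf_bound_constants_le: "C \<in> bound_constants D w W f \<Longrightarrow> Inf (bound_constants D w W f) \<le> C"
  by (simp add: cInf_lower bound_constants_bdd_below)

text \<open>The infimum is attained. Where \<open>w x > 0\<close>, the quotient of the norm of
  \<open>f x\<close> by \<open>w x\<close> is a lower bound of all constants; where
  \<open>w x = 0\<close>, any single constant already forces the norm of \<open>f x\<close> to be at
  most 0.\<close>

lemma Inf_bound_constants_mem:
  assumes "bound_constants D w W f \<noteq> {}" and w: "\<And>x. x \<in> D \<Longrightarrow> 0 \<le> w x"
  shows "Inf (bound_constants D w W f) \<in> bound_constants D w W f"
proof -
  let ?K = "bound_constants D w W f"
  have "\<parallel>f x\<parallel>\<^bsub>W\<^esub> \<le> Inf ?K * w x" if x: "x \<in> D" for x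
  proof (cases "w x = 0")
    case True
    then show ?thesis using assms(1) x by (auto simp: bound_constants_def)
  next
    case False
    then have pos: "w x > 0" using w[OF x] by simp
    have "\<parallel>f x\<parallel>\<^bsub>W\<^esub> / w x \<le> Inf ?K"
      using assms(1) pos x
      by (intro cInf_greatest) (auto simp: bound_constants_def pos_divide_le_eq)
    then show ?thesis using pos by (simp add: pos_divide_le_eq)
  qed
  moreover have "0 \<le> Inf ?K"
    using assms(1) by (intro cInf_greatest) (auto simp: bound_constants_def)
  ultimately show ?thesis by (simp add: bound_constants_def)
qed

text \<open>The definitions of the bounded map spaces ask for a constant of arbitrary sign; since
  the weights are nonnegative, it may be raised to \<open>max C 0\<close>.\<close>

lemma bound_constants_ball_ex:
  assumes "\<And>x. x \<in> D \<Longrightarrow> 0 \<le> w x"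
  shows "bound_constants D w W f \<noteq> {} \<longleftrightarrow> (\<exists>C. \<forall>x\<in>D. \<parallel>f x\<parallel>\<^bsub>W\<^esub> \<le> C * w x)"
proof
  assume "\<exists>C. \<forall>x\<in>D. \<parallel>f x\<parallel>\<^bsub>W\<^esub> \<le> C * w x"
  then obtain C where "\<forall>x\<in>D. \<parallel>f x\<parallel>\<^bsub>W\<^esub> \<le> C * w x" ..
  moreover have "C * w x \<le> max C 0 * w x" if "x \<in> D" for x
    using assms[OF that] by (intro mult_right_mono) auto
  ultimately have "max C 0 \<in> bound_constants D w W f"
    by (auto simp: bound_constants_def intro: order_trans)
  then show "bound_constants D w W f \<noteq> {}" by auto
qed (auto simp: bound_constants_def)

text \<open>Isolates what completeness needs of linear and multilinear maps alike: \<open>P\<close>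
  is an algebraic property preserved by pointwise operations and by mere pointwise limits, and
  \<open>w\<close> is the quantity with which values are compared. The norm \<open>N\<close> is
  pinned down only on bounded members of \<open>P\<close>, so that the suprema of the definitions
  can be plugged in.\<close>

locale weighted_map_space = W: banach_space W
  for D :: "'d set" and w :: "'d \<Rightarrow> real"
    and W :: "('k::{real_normed_field, banach}, 'w) normed_module"
    and P :: "('d \<Rightarrow> 'w) set" and N :: "('d \<Rightarrow> 'w) \<Rightarrow> real" +
  assumes weight_nonneg: "x \<in> D \<Longrightarrow> 0 \<le> w x"
    and maps: "P \<subseteq> D \<rightarrow>\<^sub>E carrier W"
    and zero_mem: "(\<lambda>x\<in>D. \<zero>\<^bsub>W\<^esub>) \<in> P"
    and add_mem: "f \<in> P \<Longrightarrow> g \<in> P \<Longrightarrow> (\<lambda>x\<in>D. f x \<oplus>\<^bsub>W\<^esub> g x) \<in> P"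
    and smult_mem: "f \<in> P \<Longrightarrow> (\<lambda>x\<in>D. c \<odot>\<^bsub>W\<^esub> f x) \<in> P"
    and limit_mem: "(\<And>m. s m \<in> P) \<Longrightarrow> f \<in> D \<rightarrow>\<^sub>E carrier W \<Longrightarrow>
      (\<And>x. x \<in> D \<Longrightarrow> limit_of W (\<lambda>m. s m x) (f x)) \<Longrightarrow> f \<in> P"
    and norm_eq: "f \<in> P \<Longrightarrow> bound_constants D w W f \<noteq> {} \<Longrightarrow> N f = Inf (bound_constants D w W f)"
begin

abbreviation "F \<equiv> {f \<in> P. bound_constants D w W f \<noteq> {}}"
abbreviation "M \<equiv> pointwise D W F N"

lemma value_closed: "f \<in> P \<Longrightarrow> x \<in> D \<Longrightarrow> f x \<in> carrier W"
  using maps by auto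

lemma restrict_eqI:
  assumes "f \<in> P" "\<And>x. x \<in> D \<Longrightarrow> h x = f x"
  shows "(\<lambda>x\<in>D. h x) = f"
proof (rule extensionalityI[of _ D])
  show "f \<in> extensional D" using assms(1) maps by (auto simp: PiE_def)
qed (simp_all add: assms(2))

lemma norm_mem: "f \<in> F \<Longrightarrow> N f \<in> bound_constants D w W f"
  using Inf_bound_constants_mem[of D w W f] weight_nonneg norm_eq[of f] by simp

lemma norm_le: "f \<in> P \<Longrightarrow> C \<in> bound_constants D w W f \<Longrightarrow> N f \<le> C"
  using norm_eq[of f] Inf_bound_constants_le[of C D w W f] by fastforce

lemma add_constants:
  assumes "f \<in> P" "g \<in> P" "A \<in> bound_constants D w W f" "B \<in> bound_constants D w W g"
  shows "A + B \<in> bound_constants D w W (\<lambda>x\<in>D. f x \<oplus>\<^bsub>W\<^esub> g x)"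
  using assms
  by (auto simp: bound_constants_def distrib_right value_closed
      intro!: order_trans[OF W.vnorm_triangle] add_mono)

lemma smult_constants:
  assumes "f \<in> P" "A \<in> bound_constants D w W f"
  shows "norm c * A \<in> bound_constants D w W (\<lambda>x\<in>D. c \<odot>\<^bsub>W\<^esub> f x)"
  using assms
  by (auto simp: bound_constants_def mult.assoc value_closed W.vnorm_smult intro!: mult_left_mono)

lemma zero_constants: "0 \<in> bound_constants D w W (\<lambda>x\<in>D. \<zero>\<^bsub>W\<^esub>)"
  by (simp add: bound_constants_def)

lemma F_add: "f \<in> F \<Longrightarrow> g \<in> F \<Longrightarrow> (\<lambda>x\<in>D. f x \<oplus>\<^bsub>W\<^esub> g x) \<in> F"
  using add_constants add_mem by blast

lemma F_smult: "f \<in> F \<Longrightarrow> (\<lambda>x\<in>D. c \<odot>\<^bsub>W\<^esub> f x) \<in> F"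
  using smult_constants smult_mem by blast

lemma norm_smult_le: "f \<in> F \<Longrightarrow> N (\<lambda>x\<in>D. c \<odot>\<^bsub>W\<^esub> f x) \<le> norm c * N f"
  using F_smult norm_le smult_constants norm_mem by blast

lemma normed_space: "normed_space M"
proof -
  have module: "Module.module scalar_ring M"
  proof (rule scalar_moduleI, unfold pointwise_simps)
    show "(\<lambda>x\<in>D. \<zero>\<^bsub>W\<^esub>) \<in> F" using zero_mem zero_constants by blast
    show "(\<lambda>x\<in>D. (\<lambda>x\<in>D. \<zero>\<^bsub>W\<^esub>) x \<oplus>\<^bsub>W\<^esub> f x) = f" "(\<lambda>x\<in>D. 1 \<odot>\<^bsub>W\<^esub> f x) = f" if "f \<in> F" for f
      using that value_closed by (auto intro!: restrict_eqI)
  qed (fact F_add F_smult | rule restrict_ext,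
      simp add: value_closed W.a_ac W.smult_add_left W.smult_add_right W.smult_smult)+
  have zero: "N f = 0 \<longleftrightarrow> f = (\<lambda>x\<in>D. \<zero>\<^bsub>W\<^esub>)" if f: "f \<in> F" for f
  proof
    assume "N f = 0"
    then have "\<parallel>f x\<parallel>\<^bsub>W\<^esub> \<le> 0" if "x \<in> D" for x
      using norm_mem[OF f] that by (auto simp: bound_constants_def)
    then have "f x = \<zero>\<^bsub>W\<^esub>" if "x \<in> D" for x
      using f that W.vnorm_eq_0_iff[of "f x"] W.vnorm_nonneg[of "f x"] value_closed[of f x]
      by (simp add: order.antisym)
    then show "f = (\<lambda>x\<in>D. \<zero>\<^bsub>W\<^esub>)" using f by (intro restrict_eqI[symmetric]) auto
  next
    assume "f = (\<lambda>x\<in>D. \<zero>\<^bsub>W\<^esub>)"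
    then show "N f = 0" using norm_le[of f 0] norm_mem[OF f] zero_constants f
      by (auto simp: bound_constants_def)
  qed
  have smult: "N (\<lambda>x\<in>D. c \<odot>\<^bsub>W\<^esub> f x) = norm c * N f" if f: "f \<in> F" for c f
  proof (cases "c = 0")
    case True
    have "(\<lambda>x\<in>D. c \<odot>\<^bsub>W\<^esub> f x) = (\<lambda>x\<in>D. \<zero>\<^bsub>W\<^esub>)"
      using f value_closed True by (intro restrict_ext) auto
    then show ?thesis using zero[OF F_smult[OF f, of c]] True by simp
  next
    case False
    \<comment> \<open>The reverse inequality is \<open>norm_smult_le\<close> for the scalar
      \<open>inverse c\<close>, applied to the multiple of \<open>f\<close> by
      \<open>c\<close>.\<close>
    have "(\<lambda>x\<in>D. inverse c \<odot>\<^bsub>W\<^esub> (\<lambda>x\<in>D. c \<odot>\<^bsub>W\<^esub> f x) x) = f"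
      using f value_closed False by (intro restrict_eqI) (auto simp: W.smult_smult)
    then have "N f \<le> N (\<lambda>x\<in>D. c \<odot>\<^bsub>W\<^esub> f x) / norm c"
      using norm_smult_le[OF F_smult[OF f, of c], of "inverse c"]
      by (simp add: norm_inverse divide_inverse mult.commute)
    then show ?thesis using norm_smult_le[OF f, of c] False
      by (simp add: field_simps)
  qed
  show ?thesis
    unfolding normed_space_def normed_space_axioms_def pointwise_simps
  proof (intro conjI allI impI)
    fix f g assume fg: "f \<in> F" "g \<in> F"
    then have "N f + N g \<in> bound_constants D w W (\<lambda>x\<in>D. f x \<oplus>\<^bsub>W\<^esub> g x)"
      using add_constants norm_mem by blast
    then show "N (\<lambda>x\<in>D. f x \<oplus>\<^bsub>W\<^esub> g x) \<le> N f + N g"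
      using norm_le F_add[OF fg] by blast
  qed (fact module | erule zero | erule smult)+
qed

lemma pointwise_minus:
  assumes "f \<in> F" "g \<in> F"
  shows "f \<ominus>\<^bsub>M\<^esub> g = (\<lambda>x\<in>D. f x \<ominus>\<^bsub>W\<^esub> g x)"
proof -
  interpret M: normed_space M by (rule normed_space)
  show ?thesis using assms M.minus_eq_smult[of g f]
    by (auto intro!: restrict_ext simp: W.minus_eq_smult value_closed)
qed

text \<open>The limit is built pointwise in \<open>W\<close>. The Cauchy estimates have the form
  \<open>e * w x\<close> with \<open>e\<close> independent of \<open>x\<close>, so they survive the
  pointwise limit and turn back into estimates of \<open>N\<close>.\<close>

theorem banach_space: "banach_space M"
proof -
  interpret M: normed_space M by (rule normed_space)
  have "\<exists>f\<in>F. (\<lambda>m. N (s m \<ominus>\<^bsub>M\<^esub> f)) \<longlonglongrightarrow> 0" if s: "s \<in> cauchy_seqs M" for s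
  proof -
    have sF: "s m \<in> F" for m using s by (simp add: cauchy_seqs_def)
    then have sP: "s m \<in> P" for m by blast
    have sv: "s m x \<in> carrier W" if "x \<in> D" for m x using value_closed sP that by blast
    have uniform: "\<exists>K. \<forall>p\<ge>K. \<forall>q\<ge>K. \<forall>x\<in>D. \<parallel>s p x \<ominus>\<^bsub>W\<^esub> s q x\<parallel>\<^bsub>W\<^esub> \<le> e * w x" if "e > 0" for e
    proof -
      obtain K where K: "\<forall>p\<ge>K. \<forall>q\<ge>K. N (s p \<ominus>\<^bsub>M\<^esub> s q) < e"
        using s \<open>e > 0\<close> by (auto simp: cauchy_seqs_def)
      have "\<parallel>s p x \<ominus>\<^bsub>W\<^esub> s q x\<parallel>\<^bsub>W\<^esub> \<le> e * w x" if "p \<ge> K" "q \<ge> K" "x \<in> D" for p q x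
      proof -
        have "s p \<ominus>\<^bsub>M\<^esub> s q \<in> F" using M.minus_closed[of "s p" "s q"] sF by simp
        then have "\<parallel>(s p \<ominus>\<^bsub>M\<^esub> s q) x\<parallel>\<^bsub>W\<^esub> \<le> N (s p \<ominus>\<^bsub>M\<^esub> s q) * w x"
          using norm_mem[of "s p \<ominus>\<^bsub>M\<^esub> s q"] that by (simp add: bound_constants_def)
        also have "\<dots> \<le> e * w x"
          using K that weight_nonneg[of x] by (intro mult_right_mono) (auto intro: less_imp_le)
        finally show ?thesis using pointwise_minus[OF sF sF, of p q] that by simp
      qed
      then show ?thesis by blast
    qed
    have "(\<lambda>m. s m x) \<in> cauchy_seqs W" if x: "x \<in> D" for x
    proof (rule W.cauchy_seqsI)
      fix e :: real assume "e > 0"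
      \<comment> \<open>The summand 1 keeps the denominator positive where
        \<open>w x = 0\<close>.\<close>
      then have "e / (w x + 1) > 0" using weight_nonneg[OF x] by (simp add: divide_pos_pos)
      from uniform[OF this] obtain K where
        K: "\<forall>p\<ge>K. \<forall>q\<ge>K. \<forall>x'\<in>D. \<parallel>s p x' \<ominus>\<^bsub>W\<^esub> s q x'\<parallel>\<^bsub>W\<^esub> \<le> e / (w x + 1) * w x'" ..
      have "e / (w x + 1) * w x < e" 
        using weight_nonneg[OF x] \<open>e > 0\<close> by (simp add: field_simps)
      then show "\<exists>K. \<forall>p\<ge>K. \<forall>q\<ge>K. \<parallel>s p x \<ominus>\<^bsub>W\<^esub> s q x\<parallel>\<^bsub>W\<^esub> < e"
        using K x by (intro exI[of _ K]) (auto intro: le_less_trans)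
    qed (use sv x in auto)
    then have "\<forall>x\<in>D. \<exists>y. limit_of W (\<lambda>m. s m x) y" using W.cauchy_limit by blast
    then obtain h where h: "\<And>x. x \<in> D \<Longrightarrow> limit_of W (\<lambda>m. s m x) (h x)" by metis
    define f where "f = restrict h D"
    have lim: "limit_of W (\<lambda>m. s m x) (f x)" if "x \<in> D" for x using h that by (simp add: f_def)
    have fD: "f \<in> D \<rightarrow>\<^sub>E carrier W" using h by (auto simp: f_def limit_of_def)
    have fP: "f \<in> P" by (rule limit_mem[OF sP fD lim])
    have dist: "\<exists>K. \<forall>p\<ge>K. \<forall>x\<in>D. \<parallel>s p x \<ominus>\<^bsub>W\<^esub> f x\<parallel>\<^bsub>W\<^esub> \<le> e * w x" if "e > 0" for e
    proof -
      obtain K where K: "\<forall>p\<ge>K. \<forall>q\<ge>K. \<forall>x\<in>D. \<parallel>s p x \<ominus>\<^bsub>W\<^esub> s q x\<parallel>\<^bsub>W\<^esub> \<le> e * w x"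
        using uniform[OF \<open>e > 0\<close>] by blast
      \<comment> \<open>In the uniform estimate \<open>p\<close> is kept fixed while
        \<open>q\<close> tends to infinity.\<close>
      have "\<parallel>s p x \<ominus>\<^bsub>W\<^esub> f x\<parallel>\<^bsub>W\<^esub> \<le> e * w x" if "p \<ge> K" "x \<in> D" for p x
        using K that lim[OF that(2)] sv
        by (intro LIMSEQ_le_const2[OF W.limit_of_norm[OF W.limit_of_minus[OF W.limit_of_const]]]) auto
      then show ?thesis by blast
    qed
    obtain K where K: "\<forall>p\<ge>K. \<forall>x\<in>D. \<parallel>s p x \<ominus>\<^bsub>W\<^esub> f x\<parallel>\<^bsub>W\<^esub> \<le> 1 * w x"
      using dist[of 1] by auto
    obtain C where C: "C \<in> bound_constants D w W (s K)" using sF[of K] by auto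
    \<comment> \<open>\<open>C\<close> bounds \<open>s K\<close>, and the 1 comes from the distance
      between \<open>s K x\<close> and \<open>f x\<close>, which is at most
      \<open>1 * w x\<close>.\<close>
    have "\<parallel>f x\<parallel>\<^bsub>W\<^esub> \<le> (C + 1) * w x" if x: "x \<in> D" for x
    proof -
      have "\<bar>\<parallel>s K x\<parallel>\<^bsub>W\<^esub> - \<parallel>f x\<parallel>\<^bsub>W\<^esub>\<bar> \<le> \<parallel>s K x \<ominus>\<^bsub>W\<^esub> f x\<parallel>\<^bsub>W\<^esub>"
        using W.vnorm_diff_bound[of "s K x" "f x"] sv[OF x] fD x by auto
      moreover have "\<parallel>s K x \<ominus>\<^bsub>W\<^esub> f x\<parallel>\<^bsub>W\<^esub> \<le> 1 * w x" using K x by blast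
      moreover have "\<parallel>s K x\<parallel>\<^bsub>W\<^esub> \<le> C * w x" using C x by (simp add: bound_constants_def)
      ultimately show ?thesis by (simp add: distrib_right)
    qed
    then have "C + 1 \<in> bound_constants D w W f" using C by (simp add: bound_constants_def)
    then have fF: "f \<in> F" using fP by blast
    have "(\<lambda>m. N (s m \<ominus>\<^bsub>M\<^esub> f)) \<longlonglongrightarrow> 0"
    proof (rule LIMSEQ_I)
      fix e :: real assume "e > 0"
      \<comment> \<open>Half of \<open>e\<close>, because a bound constant only gives the non-strict
        estimate \<open>N \<le> e / 2\<close>.\<close>
      then obtain K where K: "\<forall>p\<ge>K. \<forall>x\<in>D. \<parallel>s p x \<ominus>\<^bsub>W\<^esub> f x\<parallel>\<^bsub>W\<^esub> \<le> e / 2 * w x"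
        using dist[of "e / 2"] by auto
      have "norm (N (s p \<ominus>\<^bsub>M\<^esub> f) - 0) < e" if "p \<ge> K" for p
      proof -
        have mem: "s p \<ominus>\<^bsub>M\<^esub> f \<in> F" using M.minus_closed[of "s p" f] sF fF by simp
        have "e / 2 \<in> bound_constants D w W (s p \<ominus>\<^bsub>M\<^esub> f)"
          unfolding pointwise_minus[OF sF fF] using K that \<open>e > 0\<close>
          by (auto simp: bound_constants_def)
        then have "N (s p \<ominus>\<^bsub>M\<^esub> f) \<le> e / 2" using norm_le mem by blast
        moreover have "0 \<le> N (s p \<ominus>\<^bsub>M\<^esub> f)" using norm_mem[OF mem] by (simp add: bound_constants_def)
        ultimately show ?thesis using \<open>e > 0\<close> by simp
      qed
      then show "\<exists>K. \<forall>p\<ge>K. norm (N (s p \<ominus>\<^bsub>M\<^esub> f) - 0) < e" by blast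
    qed
    then show ?thesis using fF by blast
  qed
  then show ?thesis
    unfolding banach_space_def banach_space_axioms_def pointwise_simps using normed_space by blast
qed

end

section \<open>Isometric isomorphisms\<close>

lemma linear_mapsI:
  assumes "S \<in> carrier V \<rightarrow>\<^sub>E carrier W"
    and "\<And>x y. x \<in> carrier V \<Longrightarrow> y \<in> carrier V \<Longrightarrow> S (x \<oplus>\<^bsub>V\<^esub> y) = S x \<oplus>\<^bsub>W\<^esub> S y"
    and "\<And>c x. x \<in> carrier V \<Longrightarrow> S (c \<odot>\<^bsub>V\<^esub> x) = c \<odot>\<^bsub>W\<^esub> S x"
  shows "S \<in> linear_maps V W"
  using assms by (simp add: linear_maps_def)

lemma linear_maps_closed: "S \<in> linear_maps V W \<Longrightarrow> x \<in> carrier V \<Longrightarrow> S x \<in> carrier W"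
  by (auto simp: linear_maps_def)

lemma linear_maps_add:
  "S \<in> linear_maps V W \<Longrightarrow> x \<in> carrier V \<Longrightarrow> y \<in> carrier V \<Longrightarrow> S (x \<oplus>\<^bsub>V\<^esub> y) = S x \<oplus>\<^bsub>W\<^esub> S y"
  by (auto simp: linear_maps_def)

lemma linear_maps_smult:
  "S \<in> linear_maps V W \<Longrightarrow> x \<in> carrier V \<Longrightarrow> S (c \<odot>\<^bsub>V\<^esub> x) = c \<odot>\<^bsub>W\<^esub> S x"
  by (auto simp: linear_maps_def)

text \<open>The part of the vector space structure that inverting and composing isometric
  isomorphisms relies on: \<open>linear_maps\<close> does not by itself guarantee that sums and
  multiples stay in the carrier.\<close>

definition closed_under_operations :: "('k, 'v) normed_module \<Rightarrow> bool" where
  "closed_under_operations V \<longleftrightarrow>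
     (\<forall>x\<in>carrier V. \<forall>y\<in>carrier V. x \<oplus>\<^bsub>V\<^esub> y \<in> carrier V) \<and>
     (\<forall>c. \<forall>x\<in>carrier V. c \<odot>\<^bsub>V\<^esub> x \<in> carrier V)"

lemma (in seminormed_space) closed_under_operations: "closed_under_operations V"
  by (simp add: closed_under_operations_def)

lemma isometrically_isomorphic_sym:
  assumes "isometrically_isomorphic V W" and V: "closed_under_operations V"
  shows "isometrically_isomorphic W V"
proof -
  obtain \<phi> where lin: "\<phi> \<in> linear_maps V W" and bij: "bij_betw \<phi> (carrier V) (carrier W)"
    and norm: "\<And>x. x \<in> carrier V \<Longrightarrow> \<parallel>\<phi> x\<parallel>\<^bsub>W\<^esub> = \<parallel>x\<parallel>\<^bsub>V\<^esub>"
    using assms(1) by (auto simp: isometrically_isomorphic_def)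
  define \<psi> where "\<psi> = restrict (inv_into (carrier V) \<phi>) (carrier W)"
  have \<psi>: "\<psi> y \<in> carrier V" "\<phi> (\<psi> y) = y" if "y \<in> carrier W" for y
    using bij that bij_betwE[OF bij_betw_inv_into[OF bij]]
    by (auto simp: \<psi>_def bij_betw_inv_into_right)
  \<comment> \<open>Preimages are unique, so each linearity law for \<psi> is checked by applying
    \<phi> to the claimed value.\<close>
  have \<psi>I: "\<psi> y = x" if "x \<in> carrier V" "\<phi> x = y" for x y
    using that bij bij_betwE[OF bij] by (auto simp: \<psi>_def bij_betw_inv_into_left)
  have "\<psi> \<in> linear_maps W V"
  proof (rule linear_mapsI)
    show "\<psi> (x \<oplus>\<^bsub>W\<^esub> y) = \<psi> x \<oplus>\<^bsub>V\<^esub> \<psi> y" if "x \<in> carrier W" "y \<in> carrier W" for x y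
      using that \<psi> V by (intro \<psi>I) (auto simp: closed_under_operations_def linear_maps_add[OF lin])
    show "\<psi> (c \<odot>\<^bsub>W\<^esub> x) = c \<odot>\<^bsub>V\<^esub> \<psi> x" if "x \<in> carrier W" for c x
      using that \<psi> V by (intro \<psi>I) (auto simp: closed_under_operations_def linear_maps_smult[OF lin])
  qed (use \<psi> in \<open>auto simp: \<psi>_def\<close>)
  moreover have "bij_betw \<psi> (carrier W) (carrier V)"
    using bij_betw_inv_into[OF bij] by (simp add: \<psi>_def cong: bij_betw_cong)
  moreover have "\<parallel>\<psi> y\<parallel>\<^bsub>V\<^esub> = \<parallel>y\<parallel>\<^bsub>W\<^esub>" if "y \<in> carrier W" for y
    using norm[of "\<psi> y"] \<psi>[OF that] by simp
  ultimately show ?thesis by (auto simp: isometrically_isomorphic_def)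
qed

lemma isometrically_isomorphic_trans:
  assumes "isometrically_isomorphic U V" "isometrically_isomorphic V W" "closed_under_operations U"
  shows "isometrically_isomorphic U W"
proof -
  obtain \<phi> \<psi> where \<phi>: "\<phi> \<in> linear_maps U V" "bij_betw \<phi> (carrier U) (carrier V)"
      "\<And>x. x \<in> carrier U \<Longrightarrow> \<parallel>\<phi> x\<parallel>\<^bsub>V\<^esub> = \<parallel>x\<parallel>\<^bsub>U\<^esub>"
    and \<psi>: "\<psi> \<in> linear_maps V W" "bij_betw \<psi> (carrier V) (carrier W)"
      "\<And>x. x \<in> carrier V \<Longrightarrow> \<parallel>\<psi> x\<parallel>\<^bsub>W\<^esub> = \<parallel>x\<parallel>\<^bsub>V\<^esub>"
    using assms by (auto simp: isometrically_isomorphic_def)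
  let ?\<chi> = "restrict (\<psi> \<circ> \<phi>) (carrier U)"
  note closed = linear_maps_closed[OF \<phi>(1)]
  have "?\<chi> \<in> linear_maps U W"
    using assms(3) closed
    by (intro linear_mapsI) (auto simp: closed_under_operations_def linear_maps_add[OF \<phi>(1)]
        linear_maps_add[OF \<psi>(1)] linear_maps_smult[OF \<phi>(1)] linear_maps_smult[OF \<psi>(1)]
        linear_maps_closed[OF \<psi>(1)])
  moreover have "bij_betw ?\<chi> (carrier U) (carrier W)"
    using bij_betw_trans[OF \<phi>(2) \<psi>(2)] by (simp cong: bij_betw_cong)
  moreover have "\<parallel>?\<chi> x\<parallel>\<^bsub>W\<^esub> = \<parallel>x\<parallel>\<^bsub>U\<^esub>" if "x \<in> carrier U" for x
    using that closed \<phi>(3) \<psi>(3) by simp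
  ultimately show ?thesis unfolding isometrically_isomorphic_def by blast
qed

text \<open>Each law of \<open>W\<close> is carried over by writing its elements as values of
  \<phi>. The zero has to be matched by a separate premise: before \<open>W\<close> is known to be a
  module, linearity of \<phi> says nothing about the record field \<open>zero\<close> of
  \<open>W\<close>.\<close>

lemma banach_space_isometric_image:
  fixes V :: "('k::{real_normed_field, banach}, 'v) normed_module"
    and W :: "('k, 'w) normed_module"
  assumes "banach_space V"
    and lin: "\<phi> \<in> linear_maps V W" and bij: "bij_betw \<phi> (carrier V) (carrier W)"
    and norm: "\<And>x. x \<in> carrier V \<Longrightarrow> \<parallel>\<phi> x\<parallel>\<^bsub>W\<^esub> = \<parallel>x\<parallel>\<^bsub>V\<^esub>"
    and zero: "\<phi> \<zero>\<^bsub>V\<^esub> = \<zero>\<^bsub>W\<^esub>"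
  shows "banach_space W"
proof -
  interpret V: banach_space V by fact
  note add = linear_maps_add[OF lin, symmetric] and smult = linear_maps_smult[OF lin, symmetric]
  note closed = linear_maps_closed[OF lin]
  have onto: "\<exists>x\<in>carrier V. y = \<phi> x" if "y \<in> carrier W" for y
    using bij that by (auto simp: bij_betw_def)
  have inj: "\<phi> x = \<phi> y \<longleftrightarrow> x = y" if "x \<in> carrier V" "y \<in> carrier V" for x y
    using bij that by (auto simp: bij_betw_def inj_on_def)
  have module: "Module.module scalar_ring W"
    by (rule scalar_moduleI)
      (auto dest!: onto simp: add smult zero[symmetric] V.a_ac V.smult_add_left V.smult_add_right V.smult_smult
        intro!: closed)
  interpret W: normed_space W
    unfolding normed_space_def normed_space_axioms_def
    using module
    by (auto dest!: onto simp: add smult zero[symmetric] norm inj V.vnorm_smult V.vnorm_triangle V.vnorm_eq_0_iff)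
  have minus: "\<phi> x \<ominus>\<^bsub>W\<^esub> \<phi> y = \<phi> (x \<ominus>\<^bsub>V\<^esub> y)" if "x \<in> carrier V" "y \<in> carrier V" for x y
    using that closed[of y] W.minus_eq_smult[of "\<phi> y"] V.minus_eq_smult[of y]
    by (simp add: linear_maps_add[OF lin] linear_maps_smult[OF lin])
  have "\<exists>y\<in>carrier W. (\<lambda>m. \<parallel>s m \<ominus>\<^bsub>W\<^esub> y\<parallel>\<^bsub>W\<^esub>) \<longlonglongrightarrow> 0" if s: "s \<in> cauchy_seqs W" for s
  proof -
    have "\<forall>m. \<exists>x. x \<in> carrier V \<and> s m = \<phi> x" using onto[OF cauchy_seqs_closed[OF s]] by blast
    then obtain t where t: "\<And>m. t m \<in> carrier V" "\<And>m. s m = \<phi> (t m)" by metis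
    have "t \<in> cauchy_seqs V" using s t by (simp add: cauchy_seqs_def minus norm)
    then obtain x where "x \<in> carrier V" "(\<lambda>m. \<parallel>t m \<ominus>\<^bsub>V\<^esub> x\<parallel>\<^bsub>V\<^esub>) \<longlonglongrightarrow> 0"
      using V.complete by blast
    then show ?thesis using t closed by (intro bexI[of _ "\<phi> x"]) (auto simp: minus norm)
  qed
  then show ?thesis by unfold_locales
qed

section \<open>The algebraic tensor product\<close>

abbreviation (input) "keys \<equiv> Poly_Mapping.keys"
abbreviation (input) "lookup \<equiv> Poly_Mapping.lookup"
abbreviation (input) "single \<equiv> Poly_Mapping.single"

lemma lookup_free_scale: "lookup (free_scale c p) x = c * lookup p x"
  by (simp add: free_scale_def Poly_Mapping.map.rep_eq when_def)

lemma keys_free_scale: "keys (free_scale c p) \<subseteq> keys p"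
  by (auto simp: in_keys_iff lookup_free_scale)

lemma free_scale_single: "free_scale c (single x d) = single x (c * d)"
  by (simp add: free_scale_def)

interpretation free: Modules.module "free_scale :: 'k::field \<Rightarrow> ('b \<Rightarrow>\<^sub>0 'k) \<Rightarrow> _"
  by unfold_locales
    (auto intro!: poly_mapping_eqI simp: lookup_free_scale lookup_add algebra_simps)

text \<open>Plays two roles: the weight against which multilinear maps are bounded, and the cost of
  a single summand in the infimum defining \<pi>.\<close>

definition tuple_weight :: "nat \<Rightarrow> (nat \<Rightarrow> ('k, 'a) normed_module) \<Rightarrow> (nat \<Rightarrow> 'a) \<Rightarrow> real" where
  "tuple_weight n X x = (\<Prod>i=1..n. \<parallel>x i\<parallel>\<^bsub>X i\<^esub>)"

locale tensor_family =
  fixes n :: nat and X :: "nat \<Rightarrow> ('k::{real_normed_field, banach}, 'a) normed_module"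
  assumes n_pos: "1 \<le> n"
    and seminormed: "i \<in> {1..n} \<Longrightarrow> seminormed_space (X i)"
begin

abbreviation "tensor \<equiv> tensor_product n X"
abbreviation "elementary \<equiv> elementary_tensor n X"
abbreviation "relations \<equiv> free.span (multilinearity_relations n X)"
abbreviation "cls p \<equiv> tensor_rel n X `` {p}"
abbreviation "weight \<equiv> tuple_weight n X"

lemma tuples_component: "x \<in> tuples n X \<Longrightarrow> i \<in> {1..n} \<Longrightarrow> x i \<in> carrier (X i)"
  by (auto simp: tuples_def)

lemma tuples_upd:
  "x \<in> tuples n X \<Longrightarrow> i \<in> {1..n} \<Longrightarrow> a \<in> carrier (X i) \<Longrightarrow> x(i := a) \<in> tuples n X"
  by (auto simp: tuples_def PiE_def extensional_def Pi_def)

lemma component_smult: "i \<in> {1..n} \<Longrightarrow> a \<in> carrier (X i) \<Longrightarrow> c \<odot>\<^bsub>X i\<^esub> a \<in> carrier (X i)"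
  using seminormed_space.smult_closed'[OF seminormed] by blast

lemma component_add:
  assumes "i \<in> {1..n}" "a \<in> carrier (X i)" "b \<in> carrier (X i)"
  shows "a \<oplus>\<^bsub>X i\<^esub> b \<in> carrier (X i)"
proof -
  interpret seminormed_space "X i" using assms(1) by (rule seminormed)
  show ?thesis using assms by simp
qed

lemma weight_nonneg: "x \<in> tuples n X \<Longrightarrow> 0 \<le> weight x"
  unfolding tuple_weight_def
  by (intro prod_nonneg) (simp add: seminormed_space.vnorm_nonneg[OF seminormed] tuples_component)

lemma weight_smult:
  assumes "x \<in> tuples n X" "i \<in> {1..n}"
  shows "weight (x(i := c \<odot>\<^bsub>X i\<^esub> x i)) = norm c * weight x"
proof -
  have "weight (x(i := c \<odot>\<^bsub>X i\<^esub> x i)) = \<parallel>c \<odot>\<^bsub>X i\<^esub> x i\<parallel>\<^bsub>X i\<^esub> * (\<Prod>j\<in>{1..n} - {i}. \<parallel>x j\<parallel>\<^bsub>X j\<^esub>)"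
    unfolding tuple_weight_def using assms(2) by (subst prod.remove[of _ i]) auto
  moreover have "weight x = \<parallel>x i\<parallel>\<^bsub>X i\<^esub> * (\<Prod>j\<in>{1..n} - {i}. \<parallel>x j\<parallel>\<^bsub>X j\<^esub>)"
    unfolding tuple_weight_def using assms(2) by (subst prod.remove[of _ i]) auto
  ultimately show ?thesis
    using seminormed_space.vnorm_smult[OF seminormed[OF assms(2)] tuples_component[OF assms]] by simp
qed

lemma free_carrier_single: "x \<in> tuples n X \<Longrightarrow> single x c \<in> free_carrier n X"
  by (simp add: free_carrier_def)

lemma free_carrier_add: "p \<in> free_carrier n X \<Longrightarrow> q \<in> free_carrier n X \<Longrightarrow> p + q \<in> free_carrier n X"
  using keys_add[of p q] by (auto simp: free_carrier_def)

lemma free_carrier_scale: "p \<in> free_carrier n X \<Longrightarrow> free_scale c p \<in> free_carrier n X"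
  using keys_free_scale[of c p] by (auto simp: free_carrier_def)

lemma free_carrier_diff: "p \<in> free_carrier n X \<Longrightarrow> q \<in> free_carrier n X \<Longrightarrow> p - q \<in> free_carrier n X"
  using keys_diff[of p q] by (auto simp: free_carrier_def)

lemma free_carrier_0: "0 \<in> free_carrier n X"
  by (simp add: free_carrier_def)

lemma equiv_tensor_rel: "equiv (free_carrier n X) (tensor_rel n X)"
proof (rule equivI)
  show "sym (tensor_rel n X)"
    by (auto simp: sym_def tensor_rel_def dest: free.span_neg)
  show "trans (tensor_rel n X)"
  proof (rule transI)
    fix p q r assume pq: "(p, q) \<in> tensor_rel n X" and qr: "(q, r) \<in> tensor_rel n X"
    then have "(p - q) + (q - r) \<in> relations"
      by (intro free.span_add) (simp_all add: tensor_rel_def)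
    then show "(p, r) \<in> tensor_rel n X" using pq qr by (simp add: tensor_rel_def)
  qed
qed (auto simp: tensor_rel_def refl_on_def free.span_zero)

lemma cls_eq_iff:
  assumes "p \<in> free_carrier n X" "q \<in> free_carrier n X"
  shows "cls p = cls q \<longleftrightarrow> p - q \<in> relations"
  using eq_equiv_class_iff[OF equiv_tensor_rel assms] assms by (simp add: tensor_rel_def)

lemma carrier_tensor: "carrier tensor = cls ` free_carrier n X"
  by (auto simp: tensor_product_def quotient_def)

lemma cls_closed: "p \<in> free_carrier n X \<Longrightarrow> cls p \<in> carrier tensor"
  by (simp add: carrier_tensor)

lemma zero_tensor: "\<zero>\<^bsub>tensor\<^esub> = cls 0"
  by (simp add: tensor_product_def)

lemma cls_add:
  assumes "p \<in> free_carrier n X" "q \<in> free_carrier n X"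
  shows "cls p \<oplus>\<^bsub>tensor\<^esub> cls q = cls (p + q)"
proof -
  have "congruent2 (tensor_rel n X) (tensor_rel n X) (\<lambda>p q. cls (p + q))"
  proof (rule congruent2I')
    fix p p' q q' assume *: "(p, p') \<in> tensor_rel n X" "(q, q') \<in> tensor_rel n X"
    then have "(p - p') + (q - q') \<in> relations"
      by (intro free.span_add) (simp_all add: tensor_rel_def)
    then show "cls (p + q) = cls (p' + q')"
      using * by (subst cls_eq_iff) (simp_all add: tensor_rel_def free_carrier_add algebra_simps)
  qed
  from UN_equiv_class2[OF equiv_tensor_rel equiv_tensor_rel this assms] show ?thesis
    by (simp add: tensor_product_def)
qed

lemma cls_smult:
  assumes "p \<in> free_carrier n X"
  shows "c \<odot>\<^bsub>tensor\<^esub> cls p = cls (free_scale c p)"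
proof -
  have "(\<lambda>p. cls (free_scale c p)) respects tensor_rel n X"
  proof (rule congruentI)
    fix p p' assume *: "(p, p') \<in> tensor_rel n X"
    then have "free_scale c (p - p') \<in> relations"
      by (intro free.span_scale) (simp add: tensor_rel_def)
    then show "cls (free_scale c p) = cls (free_scale c p')"
      using * by (subst cls_eq_iff)
        (simp_all add: tensor_rel_def free_carrier_scale free.scale_right_diff_distrib)
  qed
  from UN_equiv_class[OF equiv_tensor_rel this assms] show ?thesis
    by (simp add: tensor_product_def)
qed

sublocale tensor: Module.module scalar_ring tensor
  by (rule scalar_moduleI)
    (auto simp: carrier_tensor zero_tensor cls_add cls_smult free_carrier_add free_carrier_scale
      free_carrier_0 add_ac free.scale_left_distrib free.scale_right_distrib)

lemma elementary_closed: "x \<in> tuples n X \<Longrightarrow> elementary x \<in> carrier tensor"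
  by (simp add: elementary_tensor_def cls_closed free_carrier_single)

lemma elementary_smult:
  assumes "x \<in> tuples n X" "i \<in> {1..n}" "a \<in> carrier (X i)"
  shows "elementary (x(i := c \<odot>\<^bsub>X i\<^esub> a)) = c \<odot>\<^bsub>tensor\<^esub> elementary (x(i := a))"
proof -
  have "single (x(i := c \<odot>\<^bsub>X i\<^esub> a)) 1 - single (x(i := a)) c \<in> relations"
    using assms by (intro free.span_base) (force simp: multilinearity_relations_def)
  then show ?thesis
    using assms by (simp add: elementary_tensor_def cls_smult free_carrier_single tuples_upd
        component_smult cls_eq_iff free_scale_single)
qed

lemma elementary_add:
  assumes "x \<in> tuples n X" "i \<in> {1..n}" "a \<in> carrier (X i)" "b \<in> carrier (X i)"
  shows "elementary (x(i := a \<oplus>\<^bsub>X i\<^esub> b)) =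
    elementary (x(i := a)) \<oplus>\<^bsub>tensor\<^esub> elementary (x(i := b))"
proof -
  have "single (x(i := a \<oplus>\<^bsub>X i\<^esub> b)) 1 - single (x(i := a)) 1 - single (x(i := b)) 1 \<in> relations"
    using assms by (intro free.span_base) (force simp: multilinearity_relations_def)
  then show ?thesis
    using assms by (simp add: elementary_tensor_def cls_add free_carrier_single tuples_upd
        component_add free_carrier_add cls_eq_iff diff_diff_eq)
qed

text \<open>A multiple of an elementary tensor is again elementary, which is why sums without
  coefficients reach every tensor. The choice of factor 1 is arbitrary.\<close>

lemma elementary_scale:
  assumes "x \<in> tuples n X"
  shows "c \<odot>\<^bsub>tensor\<^esub> elementary x = elementary (x(1 := c \<odot>\<^bsub>X 1\<^esub> x 1))"
  using elementary_smult[of x 1 "x 1" c] assms n_pos tuples_component[of x 1] by simp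

end

(* tensor_rep n X z r: some representation of z by elementary tensors has cost r in the infimum
   defining projective_norm. *)

inductive tensor_rep for n X where
  zero: "tensor_rep n X \<zero>\<^bsub>tensor_product n X\<^esub> (0::real)"
| add: "tensor_rep n X z r \<Longrightarrow> x \<in> tuples n X \<Longrightarrow>
    tensor_rep n X (z \<oplus>\<^bsub>tensor_product n X\<^esub> elementary_tensor n X x)
      (r + tuple_weight n X x)"

section \<open>Costs of representations of a tensor\<close>

context tensor_family
begin

abbreviation "rep \<equiv> tensor_rep n X"

lemma rep_closed: "rep z r \<Longrightarrow> z \<in> carrier tensor"
  by (induction rule: tensor_rep.induct) (auto intro: elementary_closed)

lemma rep_nonneg: "rep z r \<Longrightarrow> 0 \<le> r"
  by (induction rule: tensor_rep.induct) (auto intro: add_nonneg_nonneg weight_nonneg)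

text \<open>Links the inductive description to the finite sums in \<open>projective_norm\<close>:
  the rule \<open>add\<close> corresponds to passing from \<open>m\<close> to \<open>Suc m\<close>
  summands. Afterwards facts about \<pi> are proved by rule induction instead of by manipulating
  indexed sums.\<close>

lemma rep_iff_finsum:
  "rep z r \<longleftrightarrow> (\<exists>(m::nat) x. (\<forall>j<m. x j \<in> tuples n X) \<and>
     z = (\<Oplus>\<^bsub>tensor\<^esub> j\<in>{..<m}. elementary (x j)) \<and> r = (\<Sum>j<m. weight (x j)))"
proof
  assume "rep z r"
  then show "\<exists>(m::nat) x. (\<forall>j<m. x j \<in> tuples n X) \<and>
     z = (\<Oplus>\<^bsub>tensor\<^esub> j\<in>{..<m}. elementary (x j)) \<and> r = (\<Sum>j<m. weight (x j))"
  proof (induction rule: tensor_rep.induct)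
    case zero
    show ?case by (rule exI[of _ 0]) simp
  next
    case (add z r y)
    then obtain m x where x: "\<And>j::nat. j < m \<Longrightarrow> x j \<in> tuples n X"
      and z: "z = (\<Oplus>\<^bsub>tensor\<^esub> j\<in>{..<m}. elementary (x j))" and r: "r = (\<Sum>j<m. weight (x j))"
      by auto
    \<comment> \<open>Reassigning \<open>x\<close> at the index \<open>m\<close> leaves the first
      \<open>m\<close> summands unchanged.\<close>
    have eq: "(\<Oplus>\<^bsub>tensor\<^esub> j\<in>{..<m}. elementary ((x(m := y)) j)) = z"
      unfolding z by (rule tensor.M.add.finprod_cong') (auto intro: elementary_closed x)
    have "(\<Oplus>\<^bsub>tensor\<^esub> j\<in>{..<Suc m}. elementary ((x(m := y)) j)) = elementary y \<oplus>\<^bsub>tensor\<^esub> z"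
      unfolding lessThan_Suc using add.hyps(2) x
      by (subst tensor.M.finsum_insert) (auto simp: eq[unfolded fun_upd_apply] intro: elementary_closed)
    then show ?case
      using add.hyps x elementary_closed[OF add.hyps(2)] rep_closed[OF add.hyps(1)]
      by (intro exI[of _ "Suc m"] exI[of _ "x(m := y)"])
        (auto simp: less_Suc_eq r tensor.M.a_comm)
  qed
next
  assume "\<exists>(m::nat) x. (\<forall>j<m. x j \<in> tuples n X) \<and>
     z = (\<Oplus>\<^bsub>tensor\<^esub> j\<in>{..<m}. elementary (x j)) \<and> r = (\<Sum>j<m. weight (x j))"
  then obtain m :: nat and x where "\<forall>j<m. x j \<in> tuples n X"
    and "z = (\<Oplus>\<^bsub>tensor\<^esub> j\<in>{..<m}. elementary (x j))" "r = (\<Sum>j<m. weight (x j))"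
    by blast
  then show "rep z r"
  proof (induction m arbitrary: z r)
    case 0
    then show ?case by (simp add: tensor_rep.zero)
  next
    case (Suc m)
    let ?z = "\<Oplus>\<^bsub>tensor\<^esub> j\<in>{..<m}. elementary (x j)" and ?r = "\<Sum>j<m. weight (x j)"
    have rep: "rep ?z ?r" using Suc by simp
    have "z = elementary (x m) \<oplus>\<^bsub>tensor\<^esub> ?z"
      unfolding Suc.prems(2) lessThan_Suc using Suc.prems(1)
      by (subst tensor.M.finsum_insert) (auto intro: elementary_closed)
    then have "z = ?z \<oplus>\<^bsub>tensor\<^esub> elementary (x m)"
      using rep_closed[OF rep] Suc.prems(1) by (simp add: elementary_closed tensor.M.a_comm)
    then show ?case
      using tensor_rep.add[OF rep, of "x m"] Suc.prems(1,3) by simp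
  qed
qed

lemma projective_norm_eq: "projective_norm n X z = Inf {r. rep z r}"
  unfolding projective_norm_def rep_iff_finsum tuple_weight_def by (rule arg_cong[of _ _ Inf]) blast

text \<open>Concatenation of the two representations; this becomes the triangle inequality for
  \<pi>.\<close>

lemma rep_add:
  assumes "rep z r" "rep w s"
  shows "rep (z \<oplus>\<^bsub>tensor\<^esub> w) (r + s)"
  using assms(2)
proof (induction rule: tensor_rep.induct)
  case zero
  then show ?case using assms(1) rep_closed by simp
next
  case (add w s x)
  from tensor_rep.add[OF add.IH add.hyps(2)] show ?case
    using rep_closed[OF assms(1)] rep_closed[OF add.hyps(1)] elementary_closed[OF add.hyps(2)]
    by (simp add: tensor.M.a_assoc add.assoc)
qed

lemma rep_elementary: "x \<in> tuples n X \<Longrightarrow> rep (elementary x) (weight x)"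
  using tensor_rep.add[OF tensor_rep.zero, of x n X] elementary_closed[of x] by simp

text \<open>The scalar goes into the first factor of every summand, which multiplies each weight by
  \<open>norm c\<close>.\<close>

lemma rep_smult: "rep z r \<Longrightarrow> rep (c \<odot>\<^bsub>tensor\<^esub> z) (norm c * r)"
proof (induction rule: tensor_rep.induct)
  case zero
  then show ?case using tensor.smult_r_null[of c] by (simp add: tensor_rep.zero)
next
  case (add z r x)
  let ?x = "x(1 := c \<odot>\<^bsub>X 1\<^esub> x 1)"
  have "?x \<in> tuples n X" 
    using add.hyps(2) n_pos by (simp add: tuples_upd component_smult tuples_component)
  from tensor_rep.add[OF add.IH this] show ?case
    using rep_closed[OF add.hyps(1)] elementary_closed[OF add.hyps(2)] n_pos
      tensor.smult_r_distr[of c z "elementary x"] weight_smult[OF add.hyps(2), of 1 c]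
    by (simp add: elementary_scale[OF add.hyps(2)] distrib_left)
qed

text \<open>Ensures that the infimum defining \<pi> is taken over a nonempty set. The terms of a
  representative in the free vector space are split off one by one, each being a multiple of an
  elementary tensor.\<close>

lemma rep_exists:
  assumes "z \<in> carrier tensor"
  shows "\<exists>r. rep z r"
proof -
  obtain p where z: "z = cls p" and p: "keys p \<subseteq> tuples n X"
    using assms by (auto simp: carrier_tensor free_carrier_def)
  \<comment> \<open>The support is only required to lie in \<open>A\<close>: removing the term at
    \<open>x\<close> leaves an element supported in the smaller set, whether or not \<open>x\<close>
    belonged to the support.\<close>
  have "finite A \<Longrightarrow> keys p \<subseteq> A \<Longrightarrow> A \<subseteq> tuples n X \<Longrightarrow> \<exists>r. rep (cls p) r" for A p
  proof (induction A arbitrary: p rule: finite_induct)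
    case empty
    then show ?case using tensor_rep.zero[of n X] by (auto simp: zero_tensor)
  next
    case (insert x A)
    let ?s = "single x (lookup p x)"
    let ?q = "p - ?s"
    have x: "x \<in> tuples n X" using insert.prems by simp
    have "keys ?q \<subseteq> A"
      using insert.prems(1) by (auto simp: in_keys_iff lookup_minus lookup_single when_def split: if_splits)
    then obtain r where r: "rep (cls ?q) r" using insert by blast
    have q: "?q \<in> free_carrier n X" using \<open>keys ?q \<subseteq> A\<close> insert.prems by (auto simp: free_carrier_def)
    have s: "cls ?s = lookup p x \<odot>\<^bsub>tensor\<^esub> elementary x"
      using x by (simp add: elementary_tensor_def cls_smult free_carrier_single free_scale_single)
    have "rep (cls ?q \<oplus>\<^bsub>tensor\<^esub> cls ?s) (r + norm (lookup p x) * weight x)"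
      unfolding s by (intro rep_add r rep_smult rep_elementary x)
    then show ?case using q x by (auto simp: cls_add free_carrier_single)
  qed
  from this[OF finite_keys subset_refl p] show ?thesis using z by simp
qed

end

section \<open>Linearization of multilinear maps\<close>

locale tensor_multilinear = tensor_family n X + W: seminormed_space W
  for n and X :: "nat \<Rightarrow> ('k::{real_normed_field, banach}, 'a) normed_module"
    and W :: "('k, 'w) normed_module" +
  fixes T :: "(nat \<Rightarrow> 'a) \<Rightarrow> 'w"
  assumes multilinear: "T \<in> multilinear_maps n X W"
begin

lemma T_closed: "x \<in> tuples n X \<Longrightarrow> T x \<in> carrier W"
  using multilinear by (auto simp: multilinear_maps_def)

lemma T_linear: "x \<in> tuples n X \<Longrightarrow> i \<in> {1..n} \<Longrightarrow>
    (\<lambda>a\<in>carrier (X i). T (x(i := a))) \<in> linear_maps (X i) W"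
  using multilinear by (simp add: multilinear_maps_def)

lemma T_add:
  assumes "x \<in> tuples n X" "i \<in> {1..n}" "a \<in> carrier (X i)" "b \<in> carrier (X i)"
  shows "T (x(i := a \<oplus>\<^bsub>X i\<^esub> b)) = T (x(i := a)) \<oplus>\<^bsub>W\<^esub> T (x(i := b))"
  using linear_maps_add[OF T_linear[OF assms(1,2)] assms(3,4)] assms by (simp add: component_add)

lemma T_smult:
  assumes "x \<in> tuples n X" "i \<in> {1..n}" "a \<in> carrier (X i)"
  shows "T (x(i := c \<odot>\<^bsub>X i\<^esub> a)) = c \<odot>\<^bsub>W\<^esub> T (x(i := a))"
  using linear_maps_smult[OF T_linear[OF assms(1,2)] assms(3)] assms by (simp add: component_smult)

definition extension :: "((nat \<Rightarrow> 'a) \<Rightarrow>\<^sub>0 'k) \<Rightarrow> 'w" where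
  "extension p = (\<Oplus>\<^bsub>W\<^esub> x\<in>keys p. lookup p x \<odot>\<^bsub>W\<^esub> T x)"

text \<open>Terms with coefficient 0 contribute nothing. The freedom in \<open>A\<close> allows sums
  belonging to different supports to be compared over a common index set.\<close>

lemma extension_superset:
  assumes "finite A" "keys p \<subseteq> A" "A \<subseteq> tuples n X"
  shows "extension p = (\<Oplus>\<^bsub>W\<^esub> x\<in>A. lookup p x \<odot>\<^bsub>W\<^esub> T x)"
  unfolding extension_def
  by (rule W.M.add.finprod_mono_neutral_cong_left)
    (use assms T_closed in \<open>auto simp: in_keys_iff\<close>)

lemma extension_closed: "p \<in> free_carrier n X \<Longrightarrow> extension p \<in> carrier W"
  unfolding extension_def free_carrier_def
  by (rule W.M.finsum_closed) (auto intro: T_closed)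

lemma extension_add:
  assumes p: "p \<in> free_carrier n X" and q: "q \<in> free_carrier n X"
  shows "extension (p + q) = extension p \<oplus>\<^bsub>W\<^esub> extension q"
proof -
  let ?A = "keys p \<union> keys q"
  have A: "finite ?A" "?A \<subseteq> tuples n X" using assms by (auto simp: free_carrier_def)
  have "extension (p + q) = (\<Oplus>\<^bsub>W\<^esub> x\<in>?A. (lookup p x \<odot>\<^bsub>W\<^esub> T x) \<oplus>\<^bsub>W\<^esub> (lookup q x \<odot>\<^bsub>W\<^esub> T x))"
    unfolding extension_superset[OF A(1) keys_add A(2)]
    using A(2) T_closed by (intro W.M.add.finprod_cong') (auto simp: lookup_add W.smult_add_left)
  also have "\<dots> = extension p \<oplus>\<^bsub>W\<^esub> extension q"
    unfolding extension_superset[OF A(1) Un_upper1 A(2)] extension_superset[OF A(1) Un_upper2 A(2)]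
    using A(2) T_closed by (intro W.M.finsum_addf) auto
  finally show ?thesis .
qed

lemma extension_scale:
  assumes p: "p \<in> free_carrier n X"
  shows "extension (free_scale c p) = c \<odot>\<^bsub>W\<^esub> extension p"
proof -
  have A: "keys p \<subseteq> tuples n X" using assms by (auto simp: free_carrier_def)
  have "extension (free_scale c p) = (\<Oplus>\<^bsub>W\<^esub> x\<in>keys p. c \<odot>\<^bsub>W\<^esub> (lookup p x \<odot>\<^bsub>W\<^esub> T x))"
    unfolding extension_superset[OF finite_keys keys_free_scale A]
    using A T_closed by (intro W.M.add.finprod_cong') (auto simp: lookup_free_scale W.smult_smult)
  also have "\<dots> = c \<odot>\<^bsub>W\<^esub> extension p"
    unfolding extension_def using A T_closed
    by (intro W.finsum_smult_ldistr[symmetric]) auto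
  finally show ?thesis .
qed

lemma extension_single: "x \<in> tuples n X \<Longrightarrow> extension (single x c) = c \<odot>\<^bsub>W\<^esub> T x"
  using extension_superset[of "{x}" "single x c"] T_closed[of x] W.M.finsum_insert[of "{}" x]
  by simp

lemma extension_diff:
  assumes "p \<in> free_carrier n X" "q \<in> free_carrier n X"
  shows "extension (p - q) = extension p \<ominus>\<^bsub>W\<^esub> extension q"
proof -
  have "p - q = p + free_scale (-1) q"
    by (rule poly_mapping_eqI) (simp add: lookup_add lookup_minus lookup_free_scale)
  then show ?thesis
    using assms extension_add[OF assms(1) free_carrier_scale[OF assms(2)], of "-1"]
      extension_scale[OF assms(2), of "-1"]
    by (simp add: W.minus_eq_smult extension_closed)
qed

text \<open>The kernel of the extension is a subspace and contains the generating relations because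
  \<open>T\<close> is multilinear; hence it contains their span. Membership in
  \<open>free_carrier\<close> is carried along since the laws of \<open>extension\<close> are
  available only there.\<close>

lemma relations_kernel:
  assumes "p \<in> relations"
  shows "p \<in> free_carrier n X \<and> extension p = \<zero>\<^bsub>W\<^esub>"
proof -
  let ?K = "{p \<in> free_carrier n X. extension p = \<zero>\<^bsub>W\<^esub>}"
  have "free.subspace ?K"
    by (rule free.subspaceI)
      (auto simp: free_carrier_0 free_carrier_add free_carrier_scale extension_add extension_scale
        extension_def[of 0])
  moreover have "multilinearity_relations n X \<subseteq> ?K"
  proof
    fix p assume "p \<in> multilinearity_relations n X"
    then consider (add) x i a b where "x \<in> tuples n X" "i \<in> {1..n}" "a \<in> carrier (X i)" "b \<in> carrier (X i)"
        "p = single (x(i := a \<oplus>\<^bsub>X i\<^esub> b)) 1 - single (x(i := a)) 1 - single (x(i := b)) 1"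
      | (smult) x i c a where "x \<in> tuples n X" "i \<in> {1..n}" "a \<in> carrier (X i)"
        "p = single (x(i := c \<odot>\<^bsub>X i\<^esub> a)) 1 - single (x(i := a)) c"
      unfolding multilinearity_relations_def by blast
    then show "p \<in> ?K"
    proof cases
      case add
      then have "T (x(i := a)) \<in> carrier W" "T (x(i := b)) \<in> carrier W"
        by (auto intro!: T_closed tuples_upd)
      then have "T (x(i := a)) \<oplus>\<^bsub>W\<^esub> T (x(i := b)) \<ominus>\<^bsub>W\<^esub> T (x(i := a)) \<ominus>\<^bsub>W\<^esub> T (x(i := b)) = \<zero>\<^bsub>W\<^esub>"
        by (simp add: a_minus_def W.M.a_ac W.M.r_neg W.M.r_neg1 W.M.a_lcomm[of "T (x(i := b))"])
      with add show ?thesis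
        by (simp add: free_carrier_diff free_carrier_single tuples_upd component_add extension_diff
            extension_single T_closed T_add)
    next
      case smult
      then show ?thesis
        by (simp add: free_carrier_diff free_carrier_single tuples_upd component_smult extension_diff
            extension_single T_closed T_smult)
    qed
  qed
  ultimately show ?thesis using free.span_minimal assms by blast
qed

definition linearization :: "((nat \<Rightarrow> 'a) \<Rightarrow>\<^sub>0 'k) set \<Rightarrow> 'w" where
  "linearization = (\<lambda>z\<in>carrier tensor. extension (SOME p. p \<in> z))"

text \<open>Two representatives of a class differ by an element of the span of the relations, on
  which \<open>extension\<close> vanishes. So the representative picked by \<open>SOME\<close> is
  irrelevant and the map descends to the quotient.\<close>

lemma linearization_cls:
  assumes p: "p \<in> free_carrier n X"
  shows "linearization (cls p) = extension p"
proof -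
  define q where "q = (SOME q. q \<in> cls p)"
  have "p \<in> cls p" using p by (rule equiv_class_self[OF equiv_tensor_rel])
  then have "q \<in> cls p" unfolding q_def by (rule someI)
  then have q: "q \<in> free_carrier n X" "p - q \<in> relations" by (auto simp: tensor_rel_def)
  have "extension p = extension ((p - q) + q)" by simp
  also have "\<dots> = extension q"
    using relations_kernel[OF q(2)] extension_add[of "p - q" q] q(1) by (simp add: extension_closed)
  finally show ?thesis using p by (simp add: linearization_def cls_closed q_def)
qed

lemma linearization_closed: "z \<in> carrier tensor \<Longrightarrow> linearization z \<in> carrier W"
  by (auto simp: carrier_tensor linearization_cls extension_closed)

lemma linearization_add:
  "z \<in> carrier tensor \<Longrightarrow> w \<in> carrier tensor \<Longrightarrow>
    linearization (z \<oplus>\<^bsub>tensor\<^esub> w) = linearization z \<oplus>\<^bsub>W\<^esub> linearization w"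
  by (auto simp: carrier_tensor cls_add linearization_cls extension_add free_carrier_add)

lemma linearization_smult:
  "z \<in> carrier tensor \<Longrightarrow> linearization (c \<odot>\<^bsub>tensor\<^esub> z) = c \<odot>\<^bsub>W\<^esub> linearization z"
  by (auto simp: carrier_tensor cls_smult linearization_cls extension_scale free_carrier_scale)

lemma linearization_elementary: "x \<in> tuples n X \<Longrightarrow> linearization (elementary x) = T x"
  by (simp add: elementary_tensor_def linearization_cls free_carrier_single extension_single T_closed)

end

section \<open>Bounded linear and bounded multilinear maps\<close>

text \<open>\<open>U\<close> stands for a unit ball and \<open>scale\<close> for homogeneity: a
  point of positive weight is rescaled into \<open>U\<close>. Hence the upper bounds of the values
  on \<open>U\<close> are exactly the admissible constants, and the least of them is both the
  supremum and the infimum. \<open>U\<close> is a separate parameter because for multilinear maps it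
  is the product of the unit balls, in general smaller than
  \<open>{x \<in> D. w x \<le> 1}\<close>.\<close>

lemma Sup_unit_eq_Inf_bound_constants:
  assumes nonempty: "bound_constants D w W f \<noteq> {}"
    and w: "\<And>x. x \<in> D \<Longrightarrow> 0 \<le> w x"
    and U: "U \<subseteq> D" "U \<noteq> {}" "\<And>u. u \<in> U \<Longrightarrow> w u \<le> 1" "\<And>u. u \<in> U \<Longrightarrow> 0 \<le> \<parallel>f u\<parallel>\<^bsub>W\<^esub>"
    and scale: "\<And>x. x \<in> D \<Longrightarrow> 0 < w x \<Longrightarrow> \<exists>u\<in>U. \<parallel>f x\<parallel>\<^bsub>W\<^esub> = w x * \<parallel>f u\<parallel>\<^bsub>W\<^esub>"
  shows "Sup ((\<lambda>u. \<parallel>f u\<parallel>\<^bsub>W\<^esub>) ` U) = Inf (bound_constants D w W f)"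
proof -
  have upper: "(\<forall>u\<in>U. \<parallel>f u\<parallel>\<^bsub>W\<^esub> \<le> C) \<longleftrightarrow> C \<in> bound_constants D w W f" for C
  proof
    assume C: "\<forall>u\<in>U. \<parallel>f u\<parallel>\<^bsub>W\<^esub> \<le> C"
    have "\<parallel>f x\<parallel>\<^bsub>W\<^esub> \<le> C * w x" if x: "x \<in> D" for x
    proof (cases "w x = 0")
      \<comment> \<open>Points of weight 0 cannot be rescaled; here boundedness of \<open>f\<close>
        gives the norm of \<open>f x\<close> the bound 0.\<close>
      case True
      then show ?thesis using nonempty x by (auto simp: bound_constants_def)
    next
      case False
      then obtain u where "u \<in> U" "\<parallel>f x\<parallel>\<^bsub>W\<^esub> = w x * \<parallel>f u\<parallel>\<^bsub>W\<^esub>"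
        using scale[OF x] w[OF x] by auto
      then show ?thesis using C w[OF x] by (simp add: mult.commute[of C] mult_left_mono)
    qed
    moreover have "0 \<le> C" using C U by (meson all_not_in_conv order_trans)
    ultimately show "C \<in> bound_constants D w W f" by (simp add: bound_constants_def)
  next
    assume C: "C \<in> bound_constants D w W f"
    show "\<forall>u\<in>U. \<parallel>f u\<parallel>\<^bsub>W\<^esub> \<le> C"
    proof
      fix u assume u: "u \<in> U"
      then have "\<parallel>f u\<parallel>\<^bsub>W\<^esub> \<le> C * w u" using C U(1) by (auto simp: bound_constants_def)
      also have "\<dots> \<le> C" using C U(3)[OF u] by (simp add: bound_constants_def mult_left_le)
      finally show "\<parallel>f u\<parallel>\<^bsub>W\<^esub> \<le> C" .
    qed
  qed
  let ?S = "(\<lambda>u. \<parallel>f u\<parallel>\<^bsub>W\<^esub>) ` U"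
  obtain B where B: "B \<in> bound_constants D w W f" using nonempty by blast
  have bdd: "bdd_above ?S" using upper[of B] B by (auto simp: bdd_above_def)
  have "Sup ?S \<in> bound_constants D w W f"
    unfolding upper[symmetric] using bdd by (auto intro: cSup_upper)
  moreover have "Sup ?S \<le> C" if "C \<in> bound_constants D w W f" for C
    using that U(2) unfolding upper[symmetric] by (intro cSup_least) auto
  ultimately show ?thesis by (intro cInf_eq_minimum[symmetric])
qed

section \<open>Operator norms as least bound constants\<close>

context seminormed_space
begin

lemma norm_linear_map:
  fixes W :: "('k, 'w) normed_module"
  assumes "seminormed_space W" and S: "S \<in> linear_maps V W"
    and nonempty: "bound_constants (carrier V) (vnorm V) W S \<noteq> {}"
  shows "Sup {\<parallel>S x\<parallel>\<^bsub>W\<^esub> | x. x \<in> carrier V \<and> \<parallel>x\<parallel> \<le> 1} =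
    Inf (bound_constants (carrier V) (vnorm V) W S)"
proof -
  interpret W: seminormed_space W by fact
  let ?U = "{x \<in> carrier V. \<parallel>x\<parallel> \<le> 1}"
  have "Sup ((\<lambda>u. \<parallel>S u\<parallel>\<^bsub>W\<^esub>) ` ?U) = Inf (bound_constants (carrier V) (vnorm V) W S)"
  proof (rule Sup_unit_eq_Inf_bound_constants[OF nonempty])
    show "?U \<noteq> {}" using M.zero_closed vnorm_zero by (metis (mono_tags, lifting) empty_iff mem_Collect_eq zero_le_one)
    fix x assume x: "x \<in> carrier V" "0 < \<parallel>x\<parallel>"
    \<comment> \<open>The factor that normalises \<open>x\<close>; \<open>of_real\<close> embeds the
      real number into the scalar field with its absolute value as norm.\<close>
    let ?c = "of_real (1 / \<parallel>x\<parallel>) :: 'k"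
    have c: "norm ?c = 1 / \<parallel>x\<parallel>" using x(2) by (simp only: norm_of_real) simp
    have "\<parallel>?c \<odot> x\<parallel> = 1" "\<parallel>S (?c \<odot> x)\<parallel>\<^bsub>W\<^esub> = \<parallel>S x\<parallel>\<^bsub>W\<^esub> / \<parallel>x\<parallel>"
      unfolding vnorm_smult[OF x(1)] linear_maps_smult[OF S x(1)]
        W.vnorm_smult[OF linear_maps_closed[OF S x(1)]] c using x(2) by simp_all
    then show "\<exists>u\<in>?U. \<parallel>S x\<parallel>\<^bsub>W\<^esub> = \<parallel>x\<parallel> * \<parallel>S u\<parallel>\<^bsub>W\<^esub>"
      using x by (intro bexI[of _ "?c \<odot> x"]) (simp_all del: of_real_divide)
  qed (auto simp: linear_maps_closed[OF S])
  moreover have "{\<parallel>S x\<parallel>\<^bsub>W\<^esub> | x. x \<in> carrier V \<and> \<parallel>x\<parallel> \<le> 1} = (\<lambda>u. \<parallel>S u\<parallel>\<^bsub>W\<^esub>) ` ?U" by auto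
  ultimately show ?thesis by simp
qed

lemma linear_map_zero:
  assumes "seminormed_space W" "S \<in> linear_maps V W"
  shows "S \<zero> = \<zero>\<^bsub>W\<^esub>"
proof -
  interpret W: seminormed_space W by fact
  show ?thesis
    using linear_maps_smult[OF assms(2) M.zero_closed, of 0] linear_maps_closed[OF assms(2) M.zero_closed]
    by simp
qed

lemma linear_map_minus:
  assumes "seminormed_space W" "S \<in> linear_maps V W" "x \<in> carrier V" "y \<in> carrier V"
  shows "S (x \<ominus> y) = S x \<ominus>\<^bsub>W\<^esub> S y"
proof -
  interpret W: seminormed_space W by fact
  show ?thesis
    using assms(3,4) linear_maps_closed[OF assms(2)]
    by (simp add: minus_eq_smult W.minus_eq_smult linear_maps_add[OF assms(2)]
        linear_maps_smult[OF assms(2)])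
qed

lemma weighted_linear_maps:
  fixes W :: "('k, 'w) normed_module"
  assumes "banach_space W"
  shows "weighted_map_space (carrier V) (vnorm V) W (linear_maps V W)
    (\<lambda>S. Sup {\<parallel>S x\<parallel>\<^bsub>W\<^esub> | x. x \<in> carrier V \<and> \<parallel>x\<parallel> \<le> 1})"
proof -
  interpret W: banach_space W by fact
  note simps = linear_maps_add linear_maps_smult linear_maps_closed W.a_ac
    W.smult_add_right W.smult_smult
  show ?thesis
  proof
    fix f g c assume f: "f \<in> linear_maps V W" and g: "g \<in> linear_maps V W"
    show "(\<lambda>x\<in>carrier V. f x \<oplus>\<^bsub>W\<^esub> g x) \<in> linear_maps V W"
      by (rule linear_mapsI) (use f g in \<open>auto simp: simps\<close>)
  next
    fix f c assume f: "f \<in> linear_maps V W"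
    show "(\<lambda>x\<in>carrier V. c \<odot>\<^bsub>W\<^esub> f x) \<in> linear_maps V W"
      by (rule linear_mapsI) (use f in \<open>auto simp: simps mult.commute\<close>)
  next
    fix s f assume s: "\<And>m. s m \<in> linear_maps V W" and f: "f \<in> carrier V \<rightarrow>\<^sub>E carrier W"
      and lim: "\<And>x. x \<in> carrier V \<Longrightarrow> limit_of W (\<lambda>m. s m x) (f x)"
    show "f \<in> linear_maps V W"
    proof (rule linear_mapsI[OF f])
      \<comment> \<open>Both sides are limits of the same sequence, by additivity of each
        \<open>s m\<close>, and limits in \<open>W\<close> are unique.\<close>
      fix x y assume "x \<in> carrier V" "y \<in> carrier V"
      then show "f (x \<oplus> y) = f x \<oplus>\<^bsub>W\<^esub> f y"
        using lim[of "x \<oplus> y"] W.limit_of_add[OF lim[of x] lim[of y]]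
        by (intro W.limit_of_unique[of "\<lambda>m. s m (x \<oplus> y)"]) (simp_all add: linear_maps_add[OF s])
    next
      fix c x assume "x \<in> carrier V"
      then show "f (c \<odot> x) = c \<odot>\<^bsub>W\<^esub> f x"
        using lim[of "c \<odot> x"] W.limit_of_smult[OF lim[of x]]
        by (intro W.limit_of_unique[of "\<lambda>m. s m (c \<odot> x)"]) (simp_all add: linear_maps_smult[OF s])
    qed
  next
    show "(\<lambda>x\<in>carrier V. \<zero>\<^bsub>W\<^esub>) \<in> linear_maps V W" by (rule linear_mapsI) auto
    show "linear_maps V W \<subseteq> carrier V \<rightarrow>\<^sub>E carrier W" by (auto simp: linear_maps_def)
  qed (auto intro: norm_linear_map W.seminormed_space_axioms)
qed

lemma bounded_linear_space_eq:
  "bounded_linear_space V W = pointwise (carrier V) W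
     {S \<in> linear_maps V W. bound_constants (carrier V) (vnorm V) W S \<noteq> {}}
     (\<lambda>S. Sup {\<parallel>S x\<parallel>\<^bsub>W\<^esub> | x. x \<in> carrier V \<and> \<parallel>x\<parallel> \<le> 1})"
  by (simp add: bounded_linear_space_def bound_constants_ball_ex)

lemma carrier_bounded_linear_space:
  "carrier (bounded_linear_space V W) =
    {S \<in> linear_maps V W. bound_constants (carrier V) (vnorm V) W S \<noteq> {}}"
  by (simp add: bounded_linear_space_eq)

lemma norm_bounded_linear_space:
  fixes W :: "('k, 'w) normed_module"
  assumes "seminormed_space W" "S \<in> carrier (bounded_linear_space V W)"
  shows "\<parallel>S\<parallel>\<^bsub>bounded_linear_space V W\<^esub> = Inf (bound_constants (carrier V) (vnorm V) W S)"
  using norm_linear_map[OF assms(1), of S] assms(2)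
  by (simp add: carrier_bounded_linear_space) (simp add: bounded_linear_space_eq)

lemma banach_bounded_linear_space: "banach_space W \<Longrightarrow> banach_space (bounded_linear_space V W)"
  unfolding bounded_linear_space_eq
  by (rule weighted_map_space.banach_space[OF weighted_linear_maps])

end

section \<open>Norms of bounded multilinear maps\<close>

context tensor_family
begin

text \<open>The zero tuple. It shows that the product of the unit balls is nonempty and supplies a
  tuple from which the zero tensor can be formed.\<close>

lemma tuples_nonempty: "\<exists>x\<in>tuples n X. \<forall>i\<in>{1..n}. \<parallel>x i\<parallel>\<^bsub>X i\<^esub> = 0"
proof (intro bexI[of _ "\<lambda>i\<in>{1..n}. \<zero>\<^bsub>X i\<^esub>"] ballI)
  fix i assume i: "i \<in> {1..n}"
  then interpret seminormed_space "X i" by (rule seminormed)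
  show "\<parallel>(\<lambda>i\<in>{1..n}. \<zero>\<^bsub>X i\<^esub>) i\<parallel>\<^bsub>X i\<^esub> = 0" using i by simp
next
  have "\<zero>\<^bsub>X i\<^esub> \<in> carrier (X i)" if i: "i \<in> {1..n}" for i
  proof -
    interpret seminormed_space "X i" using i by (rule seminormed)
    show ?thesis by simp
  qed
  then show "(\<lambda>i\<in>{1..n}. \<zero>\<^bsub>X i\<^esub>) \<in> tuples n X" by (simp add: tuples_def)
qed

text \<open>The components are normalised one at a time, each step pulling the norm of that
  component out of \<open>T\<close> by linearity in it. Positive weight guarantees that no component
  has norm 0.\<close>

lemma norm_multilinear_map:
  fixes W :: "('k, 'w) normed_module"
  assumes "seminormed_space W" and T: "T \<in> multilinear_maps n X W"
    and nonempty: "bound_constants (tuples n X) weight W T \<noteq> {}"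
  shows "Sup {\<parallel>T x\<parallel>\<^bsub>W\<^esub> | x. x \<in> tuples n X \<and> (\<forall>i\<in>{1..n}. \<parallel>x i\<parallel>\<^bsub>X i\<^esub> \<le> 1)} =
    Inf (bound_constants (tuples n X) weight W T)"
proof -
  interpret W: seminormed_space W by fact
  interpret tensor_multilinear n X W T by unfold_locales (fact T)
  let ?U = "{x \<in> tuples n X. \<forall>i\<in>{1..n}. \<parallel>x i\<parallel>\<^bsub>X i\<^esub> \<le> 1}"
  have "Sup ((\<lambda>u. \<parallel>T u\<parallel>\<^bsub>W\<^esub>) ` ?U) = Inf (bound_constants (tuples n X) weight W T)"
  proof (rule Sup_unit_eq_Inf_bound_constants[OF nonempty weight_nonneg])
    show "?U \<noteq> {}" using tuples_nonempty by force
  next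
    fix u assume "u \<in> ?U"
    then show "weight u \<le> 1" unfolding tuple_weight_def
      by (intro prod_le_1) (auto simp: seminormed_space.vnorm_nonneg[OF seminormed] tuples_component)
  next
    fix x assume x: "x \<in> tuples n X" and "0 < weight x"
    have "\<parallel>x i\<parallel>\<^bsub>X i\<^esub> \<noteq> 0" if "i \<in> {1..n}" for i
    proof
      assume "\<parallel>x i\<parallel>\<^bsub>X i\<^esub> = 0"
      then have "weight x = 0" unfolding tuple_weight_def using that by (intro prod_zero) auto
      with \<open>0 < weight x\<close> show False by simp
    qed
    then have pos: "\<parallel>x i\<parallel>\<^bsub>X i\<^esub> > 0" if "i \<in> {1..n}" for i
      using that seminormed_space.vnorm_nonneg[OF seminormed tuples_component[OF x], of i]
      by (simp add: less_le)
    \<comment> \<open>\<open>A\<close> collects the coordinates already normalised. Agreement of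
      \<open>u\<close> with \<open>x\<close> outside \<open>A\<close> ensures that the next
      component to be rescaled is still that of \<open>x\<close>.\<close>
    have "finite A \<Longrightarrow> A \<subseteq> {1..n} \<Longrightarrow> \<exists>u\<in>tuples n X. (\<forall>i\<in>A. \<parallel>u i\<parallel>\<^bsub>X i\<^esub> \<le> 1) \<and> (\<forall>i. i \<notin> A \<longrightarrow> u i = x i) \<and>
      \<parallel>T x\<parallel>\<^bsub>W\<^esub> = (\<Prod>i\<in>A. \<parallel>x i\<parallel>\<^bsub>X i\<^esub>) * \<parallel>T u\<parallel>\<^bsub>W\<^esub>" for A
    proof (induction rule: finite_induct)
      case empty
      then show ?case using x by auto
    next
      case (insert i A)
      then obtain u where u: "u \<in> tuples n X" "\<forall>j\<in>A. \<parallel>u j\<parallel>\<^bsub>X j\<^esub> \<le> 1" "\<forall>j. j \<notin> A \<longrightarrow> u j = x j"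
        "\<parallel>T x\<parallel>\<^bsub>W\<^esub> = (\<Prod>j\<in>A. \<parallel>x j\<parallel>\<^bsub>X j\<^esub>) * \<parallel>T u\<parallel>\<^bsub>W\<^esub>" by auto
      have i: "i \<in> {1..n}" using insert.prems by simp
      let ?c = "of_real (1 / \<parallel>x i\<parallel>\<^bsub>X i\<^esub>) :: 'k"
      let ?u = "u(i := ?c \<odot>\<^bsub>X i\<^esub> x i)"
      have xi: "x i \<in> carrier (X i)" "u i = x i"
        using tuples_component[OF x i] u(3) insert.hyps by auto
      have c: "norm ?c = 1 / \<parallel>x i\<parallel>\<^bsub>X i\<^esub>" using pos[OF i] by (simp only: norm_of_real) simp
      have "T ?u = ?c \<odot>\<^bsub>W\<^esub> T u" 
        using T_smult[OF u(1) i xi(1), of ?c] xi(2)[symmetric] by simp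
      then have "\<parallel>T u\<parallel>\<^bsub>W\<^esub> = \<parallel>x i\<parallel>\<^bsub>X i\<^esub> * \<parallel>T ?u\<parallel>\<^bsub>W\<^esub>"
        using W.vnorm_smult[OF T_closed[OF u(1)], of ?c] c pos[OF i] by simp
      moreover have "\<parallel>?c \<odot>\<^bsub>X i\<^esub> x i\<parallel>\<^bsub>X i\<^esub> = 1"
        using seminormed_space.vnorm_smult[OF seminormed[OF i] xi(1), of ?c] c pos[OF i] by simp
      ultimately show ?case
        using u insert.hyps tuples_upd[OF u(1) i component_smult[OF i xi(1)]]
        by (intro bexI[of _ ?u]) (auto simp: fun_upd_def)
    qed
    from this[of "{1..n}"] show "\<exists>u\<in>?U. \<parallel>T x\<parallel>\<^bsub>W\<^esub> = weight x * \<parallel>T u\<parallel>\<^bsub>W\<^esub>"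
      by (auto simp: tuple_weight_def)
  qed (auto simp: T_closed)
  moreover have "{\<parallel>T x\<parallel>\<^bsub>W\<^esub> | x. x \<in> tuples n X \<and> (\<forall>i\<in>{1..n}. \<parallel>x i\<parallel>\<^bsub>X i\<^esub> \<le> 1)} = (\<lambda>u. \<parallel>T u\<parallel>\<^bsub>W\<^esub>) ` ?U" by auto
  ultimately show ?thesis by simp
qed

lemma multilinear_mapsI:
  assumes "T \<in> tuples n X \<rightarrow>\<^sub>E carrier W"
    and "\<And>x i a b. x \<in> tuples n X \<Longrightarrow> i \<in> {1..n} \<Longrightarrow> a \<in> carrier (X i) \<Longrightarrow> b \<in> carrier (X i) \<Longrightarrow>
      T (x(i := a \<oplus>\<^bsub>X i\<^esub> b)) = T (x(i := a)) \<oplus>\<^bsub>W\<^esub> T (x(i := b))"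
    and "\<And>x i c a. x \<in> tuples n X \<Longrightarrow> i \<in> {1..n} \<Longrightarrow> a \<in> carrier (X i) \<Longrightarrow>
      T (x(i := c \<odot>\<^bsub>X i\<^esub> a)) = c \<odot>\<^bsub>W\<^esub> T (x(i := a))"
  shows "T \<in> multilinear_maps n X W"
proof -
  have "(\<lambda>a\<in>carrier (X i). T (x(i := a))) \<in> linear_maps (X i) W"
    if "x \<in> tuples n X" "i \<in> {1..n}" for x i
    using that assms(2,3) PiE_mem[OF assms(1)]
    by (intro linear_mapsI) (auto simp: component_add component_smult tuples_upd)
  then show ?thesis using assms(1) by (simp add: multilinear_maps_def)
qed

lemma weighted_multilinear_maps:
  fixes W :: "('k, 'w) normed_module"
  assumes "banach_space W"
  shows "weighted_map_space (tuples n X) weight W (multilinear_maps n X W)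
    (\<lambda>T. Sup {\<parallel>T x\<parallel>\<^bsub>W\<^esub> | x. x \<in> tuples n X \<and> (\<forall>i\<in>{1..n}. \<parallel>x i\<parallel>\<^bsub>X i\<^esub> \<le> 1)})"
proof -
  interpret W: banach_space W by fact
  have M: "tensor_multilinear n X W T" if "T \<in> multilinear_maps n X W" for T
    by unfold_locales fact
  note rules = tensor_multilinear.T_closed[OF M] tensor_multilinear.T_add[OF M]
    tensor_multilinear.T_smult[OF M] tuples_upd component_add component_smult W.a_ac
    W.smult_add_right W.smult_smult
  show ?thesis
  proof
    fix f g assume "f \<in> multilinear_maps n X W" "g \<in> multilinear_maps n X W"
    then show "(\<lambda>x\<in>tuples n X. f x \<oplus>\<^bsub>W\<^esub> g x) \<in> multilinear_maps n X W"
      by (intro multilinear_mapsI) (simp_all add: rules)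
  next
    fix f c assume "f \<in> multilinear_maps n X W"
    then show "(\<lambda>x\<in>tuples n X. c \<odot>\<^bsub>W\<^esub> f x) \<in> multilinear_maps n X W"
      by (intro multilinear_mapsI) (simp_all add: rules mult.commute)
  next
    fix s f assume s: "\<And>m. s m \<in> multilinear_maps n X W" and f: "f \<in> tuples n X \<rightarrow>\<^sub>E carrier W"
      and lim: "\<And>x. x \<in> tuples n X \<Longrightarrow> limit_of W (\<lambda>m. s m x) (f x)"
    show "f \<in> multilinear_maps n X W"
    proof (rule multilinear_mapsI[OF f])
      fix x i a b
      assume "x \<in> tuples n X" "i \<in> {1..n}" "a \<in> carrier (X i)" "b \<in> carrier (X i)"
      then show "f (x(i := a \<oplus>\<^bsub>X i\<^esub> b)) = f (x(i := a)) \<oplus>\<^bsub>W\<^esub> f (x(i := b))"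
        using lim[of "x(i := a \<oplus>\<^bsub>X i\<^esub> b)"] W.limit_of_add[OF lim[of "x(i := a)"] lim[of "x(i := b)"]]
        by (intro W.limit_of_unique[of "\<lambda>m. s m (x(i := a \<oplus>\<^bsub>X i\<^esub> b))"])
          (simp_all add: tuples_upd component_add tensor_multilinear.T_add[OF M[OF s]])
    next
      fix x i c a assume "x \<in> tuples n X" "i \<in> {1..n}" "a \<in> carrier (X i)"
      then show "f (x(i := c \<odot>\<^bsub>X i\<^esub> a)) = c \<odot>\<^bsub>W\<^esub> f (x(i := a))"
        using lim[of "x(i := c \<odot>\<^bsub>X i\<^esub> a)"] W.limit_of_smult[OF lim[of "x(i := a)"]]
        by (intro W.limit_of_unique[of "\<lambda>m. s m (x(i := c \<odot>\<^bsub>X i\<^esub> a))"])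
          (simp_all add: tuples_upd component_smult tensor_multilinear.T_smult[OF M[OF s]])
    qed
  next
    show "(\<lambda>x\<in>tuples n X. \<zero>\<^bsub>W\<^esub>) \<in> multilinear_maps n X W"
      by (rule multilinear_mapsI) (auto simp: tuples_upd component_add component_smult)
    show "multilinear_maps n X W \<subseteq> tuples n X \<rightarrow>\<^sub>E carrier W" by (auto simp: multilinear_maps_def)
  qed (fact weight_nonneg norm_multilinear_map[OF W.seminormed_space_axioms])+
qed

lemma bounded_multilinear_space_eq:
  "bounded_multilinear_space n X W = pointwise (tuples n X) W
     {T \<in> multilinear_maps n X W. bound_constants (tuples n X) weight W T \<noteq> {}}
     (\<lambda>T. Sup {\<parallel>T x\<parallel>\<^bsub>W\<^esub> | x. x \<in> tuples n X \<and> (\<forall>i\<in>{1..n}. \<parallel>x i\<parallel>\<^bsub>X i\<^esub> \<le> 1)})"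
  unfolding bounded_multilinear_space_def
  by (simp add: bound_constants_ball_ex weight_nonneg) (simp add: tuple_weight_def)

lemma carrier_bounded_multilinear_space:
  "carrier (bounded_multilinear_space n X W) =
    {T \<in> multilinear_maps n X W. bound_constants (tuples n X) weight W T \<noteq> {}}"
  by (simp add: bounded_multilinear_space_eq)

lemma norm_bounded_multilinear_space:
  fixes W :: "('k, 'w) normed_module"
  assumes "seminormed_space W" "T \<in> carrier (bounded_multilinear_space n X W)"
  shows "\<parallel>T\<parallel>\<^bsub>bounded_multilinear_space n X W\<^esub> = Inf (bound_constants (tuples n X) weight W T)"
  using norm_multilinear_map[OF assms(1), of T] assms(2)
  by (simp add: carrier_bounded_multilinear_space) (simp add: bounded_multilinear_space_eq)

lemma banach_bounded_multilinear_space: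
  "banach_space W \<Longrightarrow> banach_space (bounded_multilinear_space n X W)"
  unfolding bounded_multilinear_space_eq
  by (rule weighted_map_space.banach_space[OF weighted_multilinear_maps])

end

section \<open>The projective seminorm\<close>

lemma projective_tensor_product_simps [simp]:
  "carrier (projective_tensor_product n X) = carrier (tensor_product n X)"
  "x \<oplus>\<^bsub>projective_tensor_product n X\<^esub> y = x \<oplus>\<^bsub>tensor_product n X\<^esub> y"
  "\<zero>\<^bsub>projective_tensor_product n X\<^esub> = \<zero>\<^bsub>tensor_product n X\<^esub>"
  "c \<odot>\<^bsub>projective_tensor_product n X\<^esub> x = c \<odot>\<^bsub>tensor_product n X\<^esub> x"
  "vnorm (projective_tensor_product n X) = projective_norm n X"
  by (simp_all add: projective_tensor_product_def module.extend_def)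

text \<open>Subtraction is computed from \<open>add\<close> and \<open>zero\<close>, which the two
  records share. Thus \<open>d_pi\<close>, formed in the plain tensor product, is the distance of
  the seminormed space.\<close>

lemma projective_tensor_product_minus:
  "x \<ominus>\<^bsub>projective_tensor_product n X\<^esub> y = x \<ominus>\<^bsub>tensor_product n X\<^esub> y"
  by (simp add: a_minus_def a_inv_def m_inv_def)

context tensor_family
begin

abbreviation "projective \<equiv> projective_tensor_product n X"

lemma projective_norm_le: "rep z r \<Longrightarrow> projective_norm n X z \<le> r"
  unfolding projective_norm_eq
  by (rule cInf_lower) (auto simp: bdd_below_def intro: rep_nonneg)

lemma projective_norm_greatest:
  assumes "z \<in> carrier tensor" "\<And>r. rep z r \<Longrightarrow> b \<le> r"
  shows "b \<le> projective_norm n X z"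
  unfolding projective_norm_eq
  using rep_exists[OF assms(1)] assms(2) by (intro cInf_greatest) auto

lemma projective_norm_elementary: "x \<in> tuples n X \<Longrightarrow> projective_norm n X (elementary x) \<le> weight x"
  by (rule projective_norm_le[OF rep_elementary])

lemma projective_norm_nonneg: "z \<in> carrier tensor \<Longrightarrow> 0 \<le> projective_norm n X z"
  by (rule projective_norm_greatest[OF _ rep_nonneg])

lemma projective_norm_smult_le:
  assumes "z \<in> carrier tensor"
  shows "projective_norm n X (c \<odot>\<^bsub>tensor\<^esub> z) \<le> norm c * projective_norm n X z"
proof (cases "c = 0")
  \<comment> \<open>Division by \<open>norm c\<close> is impossible here; the empty representation
    gives the zero tensor cost 0.\<close>
  case True
  then show ?thesis
    using projective_norm_le[OF tensor_rep.zero] tensor.smult_l_null[OF assms] by simp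
next
  case False
  have "projective_norm n X (c \<odot>\<^bsub>tensor\<^esub> z) / norm c \<le> projective_norm n X z"
    using False projective_norm_le[OF rep_smult, of z _ c]
    by (intro projective_norm_greatest[OF assms]) (simp add: divide_le_eq mult.commute)
  then show ?thesis using False by (simp add: divide_le_eq mult.commute)
qed

sublocale projective: seminormed_space projective
proof -
  have "Module.module scalar_ring projective"
    using tensor.smult_l_distr tensor.smult_r_distr tensor.smult_assoc1 tensor.smult_one
      tensor.smult_l_null
    by (intro scalar_moduleI) (auto simp: tensor.M.a_ac)
  moreover have "projective_norm n X (c \<odot>\<^bsub>tensor\<^esub> z) = norm c * projective_norm n X z"
    if z: "z \<in> carrier tensor" for c z
  proof (cases "c = 0")
    case True
    have "c \<odot>\<^bsub>tensor\<^esub> z \<in> carrier tensor" using z by simp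
    then show ?thesis
      using projective_norm_smult_le[OF z, of c] projective_norm_nonneg[of "c \<odot>\<^bsub>tensor\<^esub> z"] True by simp
  next
    case False
    have cz: "c \<odot>\<^bsub>tensor\<^esub> z \<in> carrier tensor" using z by simp
    \<comment> \<open>Equality follows by applying the one-sided estimate again, to the scalar
      \<open>inverse c\<close> and the scaled tensor.\<close>
    have "inverse c \<odot>\<^bsub>tensor\<^esub> (c \<odot>\<^bsub>tensor\<^esub> z) = z"
      using tensor.smult_assoc1[of "inverse c" c z] tensor.smult_one[of z] False z by simp
    then have "projective_norm n X z \<le> projective_norm n X (c \<odot>\<^bsub>tensor\<^esub> z) / norm c"
      using projective_norm_smult_le[OF cz, of "inverse c"]
      by (simp add: norm_inverse divide_inverse mult.commute)
    then show ?thesis using projective_norm_smult_le[OF z, of c] False by (simp add: field_simps)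
  qed
  moreover have "projective_norm n X (z \<oplus>\<^bsub>tensor\<^esub> w) \<le> projective_norm n X z + projective_norm n X w"
    if z: "z \<in> carrier tensor" and w: "w \<in> carrier tensor" for z w
  proof -
    \<comment> \<open>The two infima are taken one after the other: first over representations of
      \<open>z\<close> with that of \<open>w\<close> fixed, then over those of
      \<open>w\<close>.\<close>
    have "projective_norm n X (z \<oplus>\<^bsub>tensor\<^esub> w) - s \<le> projective_norm n X z" if "rep w s" for s
      using projective_norm_le[OF rep_add[OF _ that], of z]
      by (intro projective_norm_greatest[OF z]) (simp add: diff_le_eq)
    then have "projective_norm n X (z \<oplus>\<^bsub>tensor\<^esub> w) - projective_norm n X z \<le> projective_norm n X w"
      by (intro projective_norm_greatest[OF w]) (simp add: algebra_simps)
    then show ?thesis by simp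
  qed
  ultimately show "seminormed_space projective"
    by (simp add: seminormed_space_def seminormed_space_axioms_def)
qed

text \<open>Along a representation the bounds on the summands add up to \<open>C\<close> times its
  cost, by the triangle inequality in \<open>W\<close>. Then the infimum over all representations is
  taken.\<close>

lemma linear_map_projective_bound:
  fixes W :: "('k, 'w) normed_module"
  assumes "seminormed_space W" and S: "S \<in> linear_maps projective W"
    and C: "0 \<le> C" "\<And>x. x \<in> tuples n X \<Longrightarrow> \<parallel>S (elementary x)\<parallel>\<^bsub>W\<^esub> \<le> C * weight x"
    and z: "z \<in> carrier tensor"
  shows "\<parallel>S z\<parallel>\<^bsub>W\<^esub> \<le> C * projective_norm n X z"
proof -
  interpret W: seminormed_space W by fact
  note S_closed = linear_maps_closed[OF S, simplified]
  have rep: "\<parallel>S z\<parallel>\<^bsub>W\<^esub> \<le> C * r" if "rep z r" for z r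
    using that
  proof (induction rule: tensor_rep.induct)
    case zero
    show ?case using projective.linear_map_zero[OF assms(1) S] by simp
  next
    case (add z r x)
    note zx = rep_closed[OF add.hyps(1)] elementary_closed[OF add.hyps(2)]
    have "\<parallel>S (z \<oplus>\<^bsub>tensor\<^esub> elementary x)\<parallel>\<^bsub>W\<^esub> \<le> \<parallel>S z\<parallel>\<^bsub>W\<^esub> + \<parallel>S (elementary x)\<parallel>\<^bsub>W\<^esub>"
      using linear_maps_add[OF S, of z "elementary x"] zx S_closed by (simp add: W.vnorm_triangle)
    also have "\<dots> \<le> C * r + C * weight x" using add C(2) by (intro add_mono)
    finally show ?case by (simp add: distrib_left)
  qed
  show ?thesis
  proof (cases "C = 0")
    \<comment> \<open>The infimum argument divides by \<open>C\<close>; for \<open>C = 0\<close> any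
      one representation already gives the bound.\<close>
    case True
    then show ?thesis using rep_exists[OF z] rep by auto
  next
    case False
    then have "\<parallel>S z\<parallel>\<^bsub>W\<^esub> / C \<le> projective_norm n X z"
      using rep C(1) by (intro projective_norm_greatest[OF z]) (simp add: pos_divide_le_eq mult.commute)
    then show ?thesis using False C(1) by (simp add: pos_divide_le_eq mult.commute)
  qed
qed

text \<open>Every tensor is a finite sum of elementary tensors, so the equality spreads along a
  representation.\<close>

lemma linear_maps_projective_eqI:
  assumes S: "S \<in> linear_maps projective W" and S': "S' \<in> linear_maps projective W"
    and W: "seminormed_space W"
    and eq: "\<And>x. x \<in> tuples n X \<Longrightarrow> S (elementary x) = S' (elementary x)"
  shows "S = S'"
proof (rule PiE_ext)
  show "S \<in> carrier tensor \<rightarrow>\<^sub>E carrier W" "S' \<in> carrier tensor \<rightarrow>\<^sub>E carrier W"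
    using S S' by (simp_all add: linear_maps_def)
  fix z assume "z \<in> carrier tensor"
  then obtain r where "rep z r" using rep_exists by blast
  then show "S z = S' z"
  proof (induction rule: tensor_rep.induct)
    case zero
    show ?case using projective.linear_map_zero[OF W S] projective.linear_map_zero[OF W S'] by simp
  next
    case (add z r x)
    then show ?case
      using linear_maps_add[OF S, of z "elementary x"] linear_maps_add[OF S', of z "elementary x"]
        rep_closed[OF add.hyps(1)] elementary_closed[OF add.hyps(2)] eq by simp
  qed
qed

end

lemma (in tensor_multilinear) linearization_linear: "linearization \<in> linear_maps projective W"
proof (rule linear_mapsI)
  show "linearization \<in> carrier projective \<rightarrow>\<^sub>E carrier W"
    using linearization_closed by (simp add: linearization_def PiE_def Pi_def)
qed (simp_all add: linearization_add linearization_smult)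

section \<open>The completion of a seminormed space\<close>

lemma tendsto_0_le:
  fixes f g :: "nat \<Rightarrow> real"
  assumes "g \<longlonglongrightarrow> 0" "\<And>m. 0 \<le> f m" "\<And>m. f m \<le> g m"
  shows "f \<longlonglongrightarrow> 0"
  by (rule tendsto_sandwich[OF _ _ tendsto_const assms(1)]) (auto simp: assms)

context seminormed_space
begin

abbreviation "ccls s \<equiv> completion_rel V `` {s}"

lemma cauchy_const: "x \<in> carrier V \<Longrightarrow> (\<lambda>_. x) \<in> cauchy_seqs V"
  by (rule cauchy_seqsI) auto

lemma cauchy_add:
  assumes s: "s \<in> cauchy_seqs V" and t: "t \<in> cauchy_seqs V"
  shows "(\<lambda>m. s m \<oplus> t m) \<in> cauchy_seqs V"
proof (rule cauchy_seqsI)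
  note closed = cauchy_seqs_closed[OF s] cauchy_seqs_closed[OF t]
  fix e :: real assume "e > 0"
  then have "e / 2 > 0" by simp
  then obtain K L where K: "\<forall>p\<ge>K. \<forall>q\<ge>K. \<parallel>s p \<ominus> s q\<parallel> < e / 2"
    and L: "\<forall>p\<ge>L. \<forall>q\<ge>L. \<parallel>t p \<ominus> t q\<parallel> < e / 2"
    using s t unfolding cauchy_seqs_def by blast
  have "\<parallel>(s p \<oplus> t p) \<ominus> (s q \<oplus> t q)\<parallel> < e" if "p \<ge> max K L" "q \<ge> max K L" for p q
  proof -
    have "\<parallel>s p \<ominus> s q\<parallel> < e / 2" "\<parallel>t p \<ominus> t q\<parallel> < e / 2" using K L that by auto
    then show ?thesis
      using vnorm_triangle[of "s p \<ominus> s q" "t p \<ominus> t q"] closed by (simp add: add_minus_add)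
  qed
  then show "\<exists>N. \<forall>p\<ge>N. \<forall>q\<ge>N. \<parallel>(s p \<oplus> t p) \<ominus> (s q \<oplus> t q)\<parallel> < e" by blast
qed (simp add: cauchy_seqs_closed[OF s] cauchy_seqs_closed[OF t])

lemma cauchy_smult:
  assumes s: "s \<in> cauchy_seqs V"
  shows "(\<lambda>m. c \<odot> s m) \<in> cauchy_seqs V"
proof (rule cauchy_seqsI)
  note closed = cauchy_seqs_closed[OF s]
  fix e :: real assume "e > 0"
  \<comment> \<open>The summand 1 covers the case \<open>c = 0\<close>.\<close>
  then have "e / (norm c + 1) > 0" by (simp add: add_nonneg_pos)
  then obtain K where K: "\<forall>p\<ge>K. \<forall>q\<ge>K. \<parallel>s p \<ominus> s q\<parallel> < e / (norm c + 1)"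
    using s unfolding cauchy_seqs_def by blast
  have "\<parallel>c \<odot> s p \<ominus> c \<odot> s q\<parallel> < e" if "p \<ge> K" "q \<ge> K" for p q
  proof -
    have "\<parallel>c \<odot> s p \<ominus> c \<odot> s q\<parallel> \<le> (norm c + 1) * \<parallel>s p \<ominus> s q\<parallel>"
      using closed by (simp add: smult_minus vnorm_smult distrib_right)
    also have "\<dots> < e" 
      using K that by (simp add: pos_less_divide_eq add_nonneg_pos mult.commute)
    finally show ?thesis .
  qed
  then show "\<exists>N. \<forall>p\<ge>N. \<forall>q\<ge>N. \<parallel>c \<odot> s p \<ominus> c \<odot> s q\<parallel> < e" by blast
qed (simp add: cauchy_seqs_closed[OF s])

lemma completion_relI:
  "s \<in> cauchy_seqs V \<Longrightarrow> t \<in> cauchy_seqs V \<Longrightarrow> (\<lambda>m. \<parallel>s m \<ominus> t m\<parallel>) \<longlonglongrightarrow> 0 \<Longrightarrow> (s, t) \<in> completion_rel V"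
  by (simp add: completion_rel_def)

lemma completion_relD:
  assumes "(s, t) \<in> completion_rel V"
  shows "s \<in> cauchy_seqs V" "t \<in> cauchy_seqs V" "(\<lambda>m. \<parallel>s m \<ominus> t m\<parallel>) \<longlonglongrightarrow> 0"
  using assms by (simp_all add: completion_rel_def)

lemma equiv_completion_rel: "equiv (cauchy_seqs V) (completion_rel V)"
proof (rule equivI)
  show "completion_rel V \<subseteq> cauchy_seqs V \<times> cauchy_seqs V" by (auto simp: completion_rel_def)
  show "refl_on (cauchy_seqs V) (completion_rel V)"
    by (auto simp: refl_on_def cauchy_seqs_closed intro!: completion_relI)
  show "sym (completion_rel V)"
    by (auto simp: sym_def completion_rel_def vnorm_minus_commute[OF cauchy_seqs_closed cauchy_seqs_closed])
  show "trans (completion_rel V)"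
  proof (rule transI)
    fix s t u assume st: "(s, t) \<in> completion_rel V" and tu: "(t, u) \<in> completion_rel V"
    note s = completion_relD[OF st] and t = completion_relD[OF tu]
    have "(\<lambda>m. \<parallel>s m \<ominus> u m\<parallel>) \<longlonglongrightarrow> 0"
      using tendsto_add_zero[OF s(3) t(3)]
      by (rule tendsto_0_le)
        (simp_all add: s t cauchy_seqs_closed vnorm_minus_triangle[OF cauchy_seqs_closed cauchy_seqs_closed cauchy_seqs_closed])
    then show "(s, u) \<in> completion_rel V" using s t by (intro completion_relI)
  qed
qed

lemma ccls_eqI: "(s, t) \<in> completion_rel V \<Longrightarrow> ccls s = ccls t"
  using equiv_class_eq[OF equiv_completion_rel] .

lemma carrier_completion: "carrier (completion V) = ccls ` cauchy_seqs V"
  by (auto simp: completion_def quotient_def)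

lemma ccls_closed: "s \<in> cauchy_seqs V \<Longrightarrow> ccls s \<in> carrier (completion V)"
  by (simp add: carrier_completion)

lemma zero_completion: "\<zero>\<^bsub>completion V\<^esub> = ccls (\<lambda>_. \<zero>)"
  by (simp add: completion_def)

lemma ccls_add:
  assumes "s \<in> cauchy_seqs V" "t \<in> cauchy_seqs V"
  shows "ccls s \<oplus>\<^bsub>completion V\<^esub> ccls t = ccls (\<lambda>m. s m \<oplus> t m)"
proof -
  have "congruent2 (completion_rel V) (completion_rel V) (\<lambda>s t. ccls (\<lambda>m. s m \<oplus> t m))"
  proof (rule congruent2I', rule ccls_eqI)
    fix s s' t t' assume ss: "(s, s') \<in> completion_rel V" and tt: "(t, t') \<in> completion_rel V"
    note s = completion_relD[OF ss] and t = completion_relD[OF tt]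
    note closed = cauchy_seqs_closed[OF s(1)] cauchy_seqs_closed[OF s(2)]
      cauchy_seqs_closed[OF t(1)] cauchy_seqs_closed[OF t(2)]
    have "(\<lambda>m. \<parallel>(s m \<oplus> t m) \<ominus> (s' m \<oplus> t' m)\<parallel>) \<longlonglongrightarrow> 0"
      using tendsto_add_zero[OF s(3) t(3)]
      by (rule tendsto_0_le) (simp_all add: closed add_minus_add vnorm_triangle)
    then show "(\<lambda>m. s m \<oplus> t m, \<lambda>m. s' m \<oplus> t' m) \<in> completion_rel V"
      using s t by (intro completion_relI cauchy_add)
  qed
  from UN_equiv_class2[OF equiv_completion_rel equiv_completion_rel this assms] show ?thesis
    by (simp add: completion_def)
qed

lemma ccls_smult:
  assumes "s \<in> cauchy_seqs V"
  shows "c \<odot>\<^bsub>completion V\<^esub> ccls s = ccls (\<lambda>m. c \<odot> s m)"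
proof -
  have "(\<lambda>s. ccls (\<lambda>m. c \<odot> s m)) respects completion_rel V"
  proof (rule congruentI, rule ccls_eqI)
    fix s t assume "(s, t) \<in> completion_rel V"
    note st = completion_relD[OF this]
    note closed = cauchy_seqs_closed[OF st(1)] cauchy_seqs_closed[OF st(2)]
    have "(\<lambda>m. \<parallel>c \<odot> s m \<ominus> c \<odot> t m\<parallel>) \<longlonglongrightarrow> 0"
      using tendsto_mult_right_zero[OF st(3), of "norm c"] by (simp add: closed smult_minus vnorm_smult)
    then show "(\<lambda>m. c \<odot> s m, \<lambda>m. c \<odot> t m) \<in> completion_rel V"
      using st by (intro completion_relI cauchy_smult)
  qed
  from UN_equiv_class[OF equiv_completion_rel this assms] show ?thesis
    by (simp add: completion_def)
qed

text \<open>Justifies the \<open>THE\<close> in the definition: norms along equivalent sequences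
  differ by a null sequence, so they have the same limit, and real limits are unique.\<close>

lemma vnorm_ccls:
  assumes s: "s \<in> cauchy_seqs V" and r: "(\<lambda>m. \<parallel>s m\<parallel>) \<longlonglongrightarrow> r"
  shows "\<parallel>ccls s\<parallel>\<^bsub>completion V\<^esub> = r"
proof -
  have lim: "(\<lambda>m. \<parallel>t m\<parallel>) \<longlonglongrightarrow> r" if "t \<in> ccls s" for t
  proof -
    have "(s, t) \<in> completion_rel V" using that by simp
    note st = completion_relD[OF this]
    have "(\<lambda>m. \<bar>\<parallel>s m\<parallel> - \<parallel>t m\<parallel>\<bar>) \<longlonglongrightarrow> 0"
      using st(3) by (rule tendsto_0_le)
        (simp_all add: st cauchy_seqs_closed vnorm_diff_bound)
    from tendsto_diff[OF r tendsto_rabs_zero_cancel[OF this]] show ?thesis by simp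
  qed
  have "s \<in> ccls s" using s by (rule equiv_class_self[OF equiv_completion_rel])
  then have "(THE r. \<forall>t\<in>ccls s. (\<lambda>m. \<parallel>t m\<parallel>) \<longlonglongrightarrow> r) = r"
    using lim by (intro the_equality) (auto intro: LIMSEQ_unique)
  then show ?thesis by (simp add: completion_def)
qed

lemma tendsto_vnorm_ccls:
  assumes "s \<in> cauchy_seqs V"
  shows "(\<lambda>m. \<parallel>s m\<parallel>) \<longlonglongrightarrow> \<parallel>ccls s\<parallel>\<^bsub>completion V\<^esub>"
  using cauchy_norm_convergent[OF assms] vnorm_ccls[OF assms] by (auto simp: convergent_def)

text \<open>The module laws hold termwise for representing sequences; the laws of the seminorm are
  limits of the corresponding laws in \<open>V\<close>.\<close>

lemma seminormed_completion: "seminormed_space (completion V)"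
proof -
  note closed = cauchy_seqs_closed cauchy_add cauchy_smult cauchy_const
  note ops = ccls_add ccls_smult smult_add_left smult_add_right smult_smult
  have "Module.module scalar_ring (completion V)"
    by (rule scalar_moduleI)
      (auto simp: carrier_completion zero_completion closed ops M.a_ac)
  moreover have "\<parallel>c \<odot>\<^bsub>completion V\<^esub> A\<parallel>\<^bsub>completion V\<^esub> = norm c * \<parallel>A\<parallel>\<^bsub>completion V\<^esub>"
    if "A \<in> carrier (completion V)" for c A
  proof -
    obtain s where A: "A = ccls s" and s: "s \<in> cauchy_seqs V"
      using \<open>A \<in> _\<close> by (auto simp: carrier_completion)
    have "(\<lambda>m. \<parallel>c \<odot> s m\<parallel>) \<longlonglongrightarrow> norm c * \<parallel>A\<parallel>\<^bsub>completion V\<^esub>"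
      using tendsto_mult_left[OF tendsto_vnorm_ccls[OF s], of "norm c"]
      by (simp add: A vnorm_smult cauchy_seqs_closed[OF s])
    then show ?thesis using s by (simp add: A ccls_smult vnorm_ccls cauchy_smult)
  qed
  moreover have "\<parallel>A \<oplus>\<^bsub>completion V\<^esub> B\<parallel>\<^bsub>completion V\<^esub> \<le> \<parallel>A\<parallel>\<^bsub>completion V\<^esub> + \<parallel>B\<parallel>\<^bsub>completion V\<^esub>"
    if "A \<in> carrier (completion V)" "B \<in> carrier (completion V)" for A B
  proof -
    obtain s t where A: "A = ccls s" "s \<in> cauchy_seqs V" and B: "B = ccls t" "t \<in> cauchy_seqs V"
      using \<open>A \<in> _\<close> \<open>B \<in> _\<close> by (auto simp: carrier_completion)
    show ?thesis
      unfolding A(1) B(1) ccls_add[OF A(2) B(2)]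
      by (rule LIMSEQ_le[OF tendsto_vnorm_ccls[OF cauchy_add[OF A(2) B(2)]]
            tendsto_add[OF tendsto_vnorm_ccls[OF A(2)] tendsto_vnorm_ccls[OF B(2)]]])
        (simp add: vnorm_triangle cauchy_seqs_closed[OF A(2)] cauchy_seqs_closed[OF B(2)])
  qed
  ultimately show ?thesis by (simp add: seminormed_space_def seminormed_space_axioms_def)
qed

section \<open>Density in the completion and extension of bounded maps\<close>

abbreviation "inclusion x \<equiv> ccls (\<lambda>_. x)"

lemma inclusion_closed: "x \<in> carrier V \<Longrightarrow> inclusion x \<in> carrier (completion V)"
  by (simp add: ccls_closed cauchy_const)

lemma inclusion_norm: "x \<in> carrier V \<Longrightarrow> \<parallel>inclusion x\<parallel>\<^bsub>completion V\<^esub> = \<parallel>x\<parallel>"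
  by (simp add: vnorm_ccls cauchy_const)

text \<open>Density: a class is approximated by its own terms. The distance from
  \<open>inclusion (s p)\<close> to the class of \<open>s\<close> is the limit over \<open>q\<close>
  of the distances from \<open>s p\<close> to \<open>s q\<close>, small by the Cauchy
  property.\<close>

lemma limit_of_inclusion:
  assumes s: "s \<in> cauchy_seqs V"
  shows "limit_of (completion V) (\<lambda>m. inclusion (s m)) (ccls s)"
proof -
  interpret C: seminormed_space "completion V" by (rule seminormed_completion)
  note closed = cauchy_seqs_closed[OF s]
  have "(\<lambda>m. \<parallel>inclusion (s m) \<ominus>\<^bsub>completion V\<^esub> ccls s\<parallel>\<^bsub>completion V\<^esub>) \<longlonglongrightarrow> 0"
  proof (rule LIMSEQ_I)
    fix e :: real assume "e > 0"
    then have "e / 2 > 0" by simp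
    then obtain K where K: "\<forall>p\<ge>K. \<forall>q\<ge>K. \<parallel>s p \<ominus> s q\<parallel> < e / 2"
      using s unfolding cauchy_seqs_def by blast
    have "norm (\<parallel>inclusion (s p) \<ominus>\<^bsub>completion V\<^esub> ccls s\<parallel>\<^bsub>completion V\<^esub> - 0) < e" if p: "p \<ge> K" for p
    proof -
      \<comment> \<open>A representative, as a sequence in \<open>q\<close>, of the difference of
        the two classes. Its norms are below \<open>e / 2\<close> for \<open>q \<ge> K\<close>,
        which bounds their limit.\<close>
      let ?d = "\<lambda>q. s p \<oplus> (-1) \<odot> s q"
      have d: "?d \<in> cauchy_seqs V" using s closed by (intro cauchy_add cauchy_smult cauchy_const)
      have eq: "inclusion (s p) \<ominus>\<^bsub>completion V\<^esub> ccls s = ccls ?d"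
        using s closed by (simp add: C.minus_eq_smult ccls_closed ccls_smult ccls_add cauchy_const cauchy_smult)
      have "\<parallel>ccls ?d\<parallel>\<^bsub>completion V\<^esub> \<le> e / 2"
        using K p closed
        by (intro LIMSEQ_le_const2[OF tendsto_vnorm_ccls[OF d]] exI[of _ K])
          (auto simp flip: minus_eq_smult intro: less_imp_le)
      moreover have "0 \<le> \<parallel>ccls ?d\<parallel>\<^bsub>completion V\<^esub>" using d by (simp add: ccls_closed)
      ultimately show ?thesis using \<open>e > 0\<close> by (simp add: eq)
    qed
    then show "\<exists>K. \<forall>p\<ge>K. norm (\<parallel>inclusion (s p) \<ominus>\<^bsub>completion V\<^esub> ccls s\<parallel>\<^bsub>completion V\<^esub> - 0) < e" by blast
  qed
  then show ?thesis using closed s by (simp add: limit_of_def inclusion_closed ccls_closed)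
qed

lemma bounded_linear_limit:
  fixes W :: "('k, 'w) normed_module"
  assumes W: "seminormed_space W" and S: "S \<in> carrier (bounded_linear_space V W)"
    and lim: "limit_of V s x"
  shows "limit_of W (\<lambda>m. S (s m)) (S x)"
proof -
  interpret W: seminormed_space W by fact
  have lin: "S \<in> linear_maps V W" using S by (simp add: carrier_bounded_linear_space)
  obtain C where C: "C \<in> bound_constants (carrier V) (vnorm V) W S"
    using S by (auto simp: carrier_bounded_linear_space)
  have sx: "s m \<in> carrier V" "x \<in> carrier V" for m using lim by (simp_all add: limit_of_def)
  have "(\<lambda>m. \<parallel>S (s m) \<ominus>\<^bsub>W\<^esub> S x\<parallel>\<^bsub>W\<^esub>) \<longlonglongrightarrow> 0"
  proof (rule tendsto_0_le)
    show "(\<lambda>m. C * \<parallel>s m \<ominus> x\<parallel>) \<longlonglongrightarrow> 0"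
      using lim by (auto simp: limit_of_def intro: tendsto_mult_right_zero)
    show "\<parallel>S (s m) \<ominus>\<^bsub>W\<^esub> S x\<parallel>\<^bsub>W\<^esub> \<le> C * \<parallel>s m \<ominus> x\<parallel>" for m
      using bound_constantsD[OF C M.minus_closed[OF sx]] linear_map_minus[OF W lin sx] by simp
  qed (simp add: sx linear_maps_closed[OF lin])
  then show ?thesis by (simp add: limit_of_def sx linear_maps_closed[OF lin])
qed

lemma bounded_linear_cauchy:
  fixes W :: "('k, 'w) normed_module"
  assumes W: "seminormed_space W" and S: "S \<in> carrier (bounded_linear_space V W)"
    and s: "s \<in> cauchy_seqs V"
  shows "(\<lambda>m. S (s m)) \<in> cauchy_seqs W"
proof -
  interpret W: seminormed_space W by fact
  have lin: "S \<in> linear_maps V W" using S by (simp add: carrier_bounded_linear_space)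
  obtain C where C: "C \<in> bound_constants (carrier V) (vnorm V) W S"
    using S by (auto simp: carrier_bounded_linear_space)
  note closed = cauchy_seqs_closed[OF s]
  show ?thesis
  proof (rule W.cauchy_seqsI)
    fix e :: real assume "e > 0"
    have C0: "C \<ge> 0" using C by (simp add: bound_constants_def)
    \<comment> \<open>The summand 1 covers the case \<open>C = 0\<close>.\<close>
    then have "e / (C + 1) > 0" using \<open>e > 0\<close> by simp
    then obtain K where K: "\<forall>p\<ge>K. \<forall>q\<ge>K. \<parallel>s p \<ominus> s q\<parallel> < e / (C + 1)"
      using s unfolding cauchy_seqs_def by blast
    have "\<parallel>S (s p) \<ominus>\<^bsub>W\<^esub> S (s q)\<parallel>\<^bsub>W\<^esub> < e" if "p \<ge> K" "q \<ge> K" for p q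
    proof -
      have "\<parallel>S (s p) \<ominus>\<^bsub>W\<^esub> S (s q)\<parallel>\<^bsub>W\<^esub> \<le> C * \<parallel>s p \<ominus> s q\<parallel>"
        using bound_constantsD[OF C M.minus_closed[OF closed closed]] linear_map_minus[OF W lin closed closed]
        by simp
      also have "\<dots> \<le> (C + 1) * \<parallel>s p \<ominus> s q\<parallel>" using closed by (simp add: distrib_right)
      also have "\<dots> < e" using K that C0 by (simp add: pos_less_divide_eq mult.commute)
      finally show ?thesis .
    qed
    then show "\<exists>N. \<forall>p\<ge>N. \<forall>q\<ge>N. \<parallel>S (s p) \<ominus>\<^bsub>W\<^esub> S (s q)\<parallel>\<^bsub>W\<^esub> < e" by blast
  qed (simp add: closed linear_maps_closed[OF lin])
qed

definition completion_restrict :: "((nat \<Rightarrow> 'v) set \<Rightarrow> 'w) \<Rightarrow> 'v \<Rightarrow> 'w" where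
  "completion_restrict U = (\<lambda>x\<in>carrier V. U (inclusion x))"

lemma completion_restrict_linear:
  assumes "U \<in> linear_maps (completion V) W"
  shows "completion_restrict U \<in> linear_maps V W"
proof (rule linear_mapsI)
  show "completion_restrict U (x \<oplus> y) = completion_restrict U x \<oplus>\<^bsub>W\<^esub> completion_restrict U y"
    if "x \<in> carrier V" "y \<in> carrier V" for x y
    using linear_maps_add[OF assms inclusion_closed inclusion_closed, of x y] that
    by (simp add: completion_restrict_def ccls_add cauchy_const)
  show "completion_restrict U (c \<odot> x) = c \<odot>\<^bsub>W\<^esub> completion_restrict U x" if "x \<in> carrier V" for c x
    using linear_maps_smult[OF assms inclusion_closed, of x c] that
    by (simp add: completion_restrict_def ccls_smult cauchy_const)
qed (use linear_maps_closed[OF assms inclusion_closed] in \<open>simp add: completion_restrict_def\<close>)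

text \<open>Density combined with continuity of \<open>U\<close>. It recovers \<open>U\<close> from
  its restriction, and so gives injectivity of restriction and the transfer of bounds to the
  completion.\<close>

lemma limit_of_completion_restrict:
  fixes W :: "('k, 'w) normed_module"
  assumes W: "seminormed_space W" and U: "U \<in> carrier (bounded_linear_space (completion V) W)"
    and s: "s \<in> cauchy_seqs V"
  shows "limit_of W (\<lambda>m. completion_restrict U (s m)) (U (ccls s))"
  using seminormed_space.bounded_linear_limit[OF seminormed_completion W U limit_of_inclusion[OF s]]
  by (simp add: completion_restrict_def cauchy_seqs_closed[OF s])

text \<open>A bound on \<open>V\<close> passes to limits of Cauchy sequences; conversely a bound on
  the completion restricts because the inclusion preserves norms.\<close>

lemma completion_restrict_constants:
  fixes W :: "('k, 'w) normed_module"
  assumes W: "seminormed_space W" and U: "U \<in> carrier (bounded_linear_space (completion V) W)"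
  shows "bound_constants (carrier V) (vnorm V) W (completion_restrict U) =
    bound_constants (carrier (completion V)) (vnorm (completion V)) W U"
proof (intro equalityI subsetI)
  interpret W: seminormed_space W by fact
  fix C assume C: "C \<in> bound_constants (carrier V) (vnorm V) W (completion_restrict U)"
  have "\<parallel>U (ccls s)\<parallel>\<^bsub>W\<^esub> \<le> C * \<parallel>ccls s\<parallel>\<^bsub>completion V\<^esub>" if s: "s \<in> cauchy_seqs V" for s
    using C cauchy_seqs_closed[OF s]
    by (intro LIMSEQ_le[OF W.limit_of_norm[OF limit_of_completion_restrict[OF W U s]]
          tendsto_mult_left[OF tendsto_vnorm_ccls[OF s]]])
      (auto simp: bound_constants_def)
  then show "C \<in> bound_constants (carrier (completion V)) (vnorm (completion V)) W U"
    using C by (auto simp: bound_constants_def carrier_completion)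
next
  fix C assume "C \<in> bound_constants (carrier (completion V)) (vnorm (completion V)) W U"
  then show "C \<in> bound_constants (carrier V) (vnorm V) W (completion_restrict U)"
    using inclusion_closed inclusion_norm by (fastforce simp: bound_constants_def completion_restrict_def)
qed

text \<open>Bounded maps send Cauchy sequences to Cauchy sequences, and completeness of
  \<open>W\<close> provides the limit that serves as the value on the class.\<close>

lemma bounded_linear_extension:
  fixes W :: "('k, 'w) normed_module"
  assumes "banach_space W" and S: "S \<in> carrier (bounded_linear_space V W)"
  shows "\<exists>U\<in>carrier (bounded_linear_space (completion V) W). completion_restrict U = S"
proof -
  interpret W: banach_space W by fact
  note W = W.seminormed_space_axioms
  interpret C: seminormed_space "completion V" by (rule seminormed_completion)
  have lin: "S \<in> linear_maps V W" using S by (simp add: carrier_bounded_linear_space)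
  obtain C where C: "C \<in> bound_constants (carrier V) (vnorm V) W S"
    using S by (auto simp: carrier_bounded_linear_space)
  \<comment> \<open>The value is required to be the limit along all members of the class
    simultaneously, so no representative has to be selected; the next fact shows that such a value
    exists.\<close>
  define U where "U = (\<lambda>A\<in>carrier (completion V). SOME y. \<forall>s\<in>A. limit_of W (\<lambda>m. S (s m)) y)"
  have U: "limit_of W (\<lambda>m. S (s m)) (U (ccls s))" if s: "s \<in> cauchy_seqs V" for s
  proof -
    obtain y where y: "limit_of W (\<lambda>m. S (s m)) y"
      using W.cauchy_limit[OF bounded_linear_cauchy[OF W S s]] by blast
    have "limit_of W (\<lambda>m. S (t m)) y" if "t \<in> ccls s" for t
    proof -
      have "(s, t) \<in> completion_rel V" using that by simp
      note st = completion_relD[OF this]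
      note closed = cauchy_seqs_closed[OF st(1)] cauchy_seqs_closed[OF st(2)]
      \<comment> \<open>Equivalent sequences differ by a null sequence, which \<open>S\<close> maps
        to a null sequence. Subtracting its image from \<open>S (s m)\<close> gives
        \<open>S (t m)\<close> without changing the limit.\<close>
      have "limit_of V (\<lambda>m. s m \<ominus> t m) \<zero>" using st(3) by (simp add: limit_of_def closed)
      from bounded_linear_limit[OF W S this]
      have "limit_of W (\<lambda>m. S (s m \<ominus> t m)) \<zero>\<^bsub>W\<^esub>" by (simp add: linear_map_zero[OF W lin])
      from W.limit_of_minus[OF y this] have "limit_of W (\<lambda>m. S (s m) \<ominus>\<^bsub>W\<^esub> S (s m \<ominus> t m)) y"
        using y by (simp add: limit_of_def)
      moreover have "s m \<ominus> (s m \<ominus> t m) = t m" for m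
        using closed[of m] by (simp add: minus_eq_smult smult_add_right smult_smult
            M.a_assoc[symmetric]) (simp flip: minus_eq_smult)
      then have "S (s m) \<ominus>\<^bsub>W\<^esub> S (s m \<ominus> t m) = S (t m)" for m
        using linear_map_minus[OF W lin, of "s m" "s m \<ominus> t m"] closed by simp
      ultimately show ?thesis by simp
    qed
    then have "\<forall>t\<in>ccls s. limit_of W (\<lambda>m. S (t m)) (SOME y. \<forall>t\<in>ccls s. limit_of W (\<lambda>m. S (t m)) y)"
      by (intro someI[of "\<lambda>y. \<forall>t\<in>ccls s. limit_of W (\<lambda>m. S (t m)) y" y]) blast
    then show ?thesis
      using equiv_class_self[OF equiv_completion_rel s] ccls_closed[OF s] by (simp add: U_def)
  qed
  have Ucls: "U (ccls s) \<in> carrier W" if "s \<in> cauchy_seqs V" for s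
    using U[OF that] by (simp add: limit_of_def)
  have "U \<in> linear_maps (completion V) W"
  proof (rule linear_mapsI)
    show "U \<in> carrier (completion V) \<rightarrow>\<^sub>E carrier W"
    proof (rule PiE_I)
      show "U A \<in> carrier W" if "A \<in> carrier (completion V)" for A
        using that Ucls by (auto simp: carrier_completion)
    qed (simp add: U_def)
  next
    fix A B assume "A \<in> carrier (completion V)" "B \<in> carrier (completion V)"
    then obtain s t where A: "A = ccls s" "s \<in> cauchy_seqs V" and B: "B = ccls t" "t \<in> cauchy_seqs V"
      by (auto simp: carrier_completion)
    show "U (A \<oplus>\<^bsub>completion V\<^esub> B) = U A \<oplus>\<^bsub>W\<^esub> U B"
      using W.limit_of_unique[OF U[OF cauchy_add[OF A(2) B(2)]]] W.limit_of_add[OF U[OF A(2)] U[OF B(2)]]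
      by (simp add: A B ccls_add linear_maps_add[OF lin] cauchy_seqs_closed)
  next
    fix c A assume "A \<in> carrier (completion V)"
    then obtain s where A: "A = ccls s" "s \<in> cauchy_seqs V" by (auto simp: carrier_completion)
    show "U (c \<odot>\<^bsub>completion V\<^esub> A) = c \<odot>\<^bsub>W\<^esub> U A"
      using W.limit_of_unique[OF U[OF cauchy_smult[OF A(2)]]] W.limit_of_smult[OF U[OF A(2)], of c]
      by (simp add: A ccls_smult linear_maps_smult[OF lin] cauchy_seqs_closed)
  qed
  moreover have "C \<in> bound_constants (carrier (completion V)) (vnorm (completion V)) W U"
  proof -
    have "\<parallel>U (ccls s)\<parallel>\<^bsub>W\<^esub> \<le> C * \<parallel>ccls s\<parallel>\<^bsub>completion V\<^esub>" if s: "s \<in> cauchy_seqs V" for s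
      using C cauchy_seqs_closed[OF s]
      by (intro LIMSEQ_le[OF W.limit_of_norm[OF U[OF s]] tendsto_mult_left[OF tendsto_vnorm_ccls[OF s]]])
        (auto simp: bound_constants_def)
    then show ?thesis using C by (auto simp: bound_constants_def carrier_completion)
  qed
  moreover have "completion_restrict U = S"
  proof (rule PiE_ext)
    show "S \<in> carrier V \<rightarrow>\<^sub>E carrier W" using lin by (simp add: linear_maps_def)
    show "completion_restrict U \<in> carrier V \<rightarrow>\<^sub>E carrier W"
      using Ucls cauchy_const by (simp add: completion_restrict_def)
    fix x assume x: "x \<in> carrier V"
    from W.limit_of_unique[OF U[OF cauchy_const[OF x]] W.limit_of_const]
    show "completion_restrict U x = S x"
      using x linear_maps_closed[OF lin x] by (simp add: completion_restrict_def)
  qed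
  ultimately show ?thesis
    by (intro bexI[of _ U]) (auto simp: C.carrier_bounded_linear_space)
qed

text \<open>The isomorphism is restriction to the image of \<open>V\<close>: injective by density,
  surjective because \<open>W\<close> is complete, isometric because the admissible constants
  agree.\<close>

lemma bounded_linear_completion_isomorphic:
  fixes W :: "('k, 'w) normed_module"
  assumes "banach_space W"
  shows "isometrically_isomorphic (bounded_linear_space (completion V) W) (bounded_linear_space V W)"
proof -
  interpret W: banach_space W by fact
  note W = W.seminormed_space_axioms
  interpret C: seminormed_space "completion V" by (rule seminormed_completion)
  let ?B = "bounded_linear_space (completion V) W"
  let ?\<phi> = "restrict completion_restrict (carrier ?B)"
  interpret B: banach_space ?B by (rule C.banach_bounded_linear_space) fact
  have closed: "completion_restrict U \<in> carrier (bounded_linear_space V W)" if U: "U \<in> carrier ?B" for U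
    using U completion_restrict_linear[of U W] completion_restrict_constants[OF W U]
    by (simp add: C.carrier_bounded_linear_space carrier_bounded_linear_space)
  have "?\<phi> \<in> linear_maps ?B (bounded_linear_space V W)"
  proof (rule linear_mapsI)
    show "?\<phi> (f \<oplus>\<^bsub>?B\<^esub> g) = ?\<phi> f \<oplus>\<^bsub>bounded_linear_space V W\<^esub> ?\<phi> g"
      if "f \<in> carrier ?B" "g \<in> carrier ?B" for f g
      using that B.M.a_closed[OF that]
      by (simp, simp add: bounded_linear_space_def completion_restrict_def inclusion_closed cong: restrict_cong)
    show "?\<phi> (c \<odot>\<^bsub>?B\<^esub> f) = c \<odot>\<^bsub>bounded_linear_space V W\<^esub> ?\<phi> f"
      if "f \<in> carrier ?B" for c f
      using that B.smult_closed'[OF that, of c]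
      by (simp, simp add: bounded_linear_space_def completion_restrict_def inclusion_closed cong: restrict_cong)
  qed (use closed in simp)
  moreover have "inj_on completion_restrict (carrier ?B)"
  proof (rule inj_onI)
    fix U U' assume U: "U \<in> carrier ?B" and U': "U' \<in> carrier ?B"
      and eq: "completion_restrict U = completion_restrict U'"
    show "U = U'"
    proof (rule PiE_ext)
      show "U \<in> carrier (completion V) \<rightarrow>\<^sub>E carrier W" "U' \<in> carrier (completion V) \<rightarrow>\<^sub>E carrier W"
        using U U' by (simp_all add: C.carrier_bounded_linear_space linear_maps_def)
      fix A assume "A \<in> carrier (completion V)"
      then obtain s where "A = ccls s" "s \<in> cauchy_seqs V" by (auto simp: carrier_completion)
      then show "U A = U' A"
        using W.limit_of_unique[OF limit_of_completion_restrict[OF W U]]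
          limit_of_completion_restrict[OF W U'] eq by simp
    qed
  qed
  then have "bij_betw ?\<phi> (carrier ?B) (carrier (bounded_linear_space V W))"
    using bounded_linear_extension[OF assms] closed
    by (auto simp: bij_betw_def)
  moreover have "\<parallel>?\<phi> U\<parallel>\<^bsub>bounded_linear_space V W\<^esub> = \<parallel>U\<parallel>\<^bsub>?B\<^esub>" if U: "U \<in> carrier ?B" for U
    using norm_bounded_linear_space[OF W closed[OF U]] C.norm_bounded_linear_space[OF W U]
      completion_restrict_constants[OF W U] U by simp
  ultimately show ?thesis unfolding isometrically_isomorphic_def by blast
qed

end

section \<open>Lipschitz Sigma-operators\<close>

context tensor_family
begin

definition tensor_restrict :: "(((nat \<Rightarrow> 'a) \<Rightarrow>\<^sub>0 'k) set \<Rightarrow> 'w) \<Rightarrow> (nat \<Rightarrow> 'a) \<Rightarrow> 'w" where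
  "tensor_restrict S = (\<lambda>x\<in>tuples n X. S (elementary x))"

lemma tensor_restrict_multilinear:
  assumes S: "S \<in> linear_maps projective W"
  shows "tensor_restrict S \<in> multilinear_maps n X W"
proof (rule multilinear_mapsI)
  show "tensor_restrict S \<in> tuples n X \<rightarrow>\<^sub>E carrier W"
    using linear_maps_closed[OF S] by (simp add: tensor_restrict_def elementary_closed)
next
  fix x i a b assume "x \<in> tuples n X" "i \<in> {1..n}" "a \<in> carrier (X i)" "b \<in> carrier (X i)"
  then show "tensor_restrict S (x(i := a \<oplus>\<^bsub>X i\<^esub> b)) =
      tensor_restrict S (x(i := a)) \<oplus>\<^bsub>W\<^esub> tensor_restrict S (x(i := b))"
    using linear_maps_add[OF S, of "elementary (x(i := a))" "elementary (x(i := b))"]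
    by (simp add: tensor_restrict_def elementary_add elementary_closed tuples_upd component_add)
next
  fix x i c a assume "x \<in> tuples n X" "i \<in> {1..n}" "a \<in> carrier (X i)"
  then show "tensor_restrict S (x(i := c \<odot>\<^bsub>X i\<^esub> a)) = c \<odot>\<^bsub>W\<^esub> tensor_restrict S (x(i := a))"
    using linear_maps_smult[OF S, of "elementary (x(i := a))" c]
    by (simp add: tensor_restrict_def elementary_smult elementary_closed tuples_upd component_smult)
qed

text \<open>One inclusion is the summandwise estimate \<open>linear_map_projective_bound\<close>;
  the other holds because the one-term representation gives \<pi> at most the weight on an
  elementary tensor.\<close>

lemma tensor_restrict_constants:
  fixes W :: "('k, 'w) normed_module"
  assumes W: "seminormed_space W" and S: "S \<in> linear_maps projective W"
  shows "bound_constants (tuples n X) weight W (tensor_restrict S) =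
    bound_constants (carrier projective) (vnorm projective) W S"
proof (intro equalityI subsetI)
  fix C assume "C \<in> bound_constants (tuples n X) weight W (tensor_restrict S)"
  then show "C \<in> bound_constants (carrier projective) (vnorm projective) W S"
    using linear_map_projective_bound[OF W S, of C] by (simp add: bound_constants_def tensor_restrict_def)
next
  fix C assume C: "C \<in> bound_constants (carrier projective) (vnorm projective) W S"
  have "\<parallel>S (elementary x)\<parallel>\<^bsub>W\<^esub> \<le> C * weight x" if x: "x \<in> tuples n X" for x
  proof -
    have "\<parallel>S (elementary x)\<parallel>\<^bsub>W\<^esub> \<le> C * projective_norm n X (elementary x)"
      using C elementary_closed[OF x] by (simp add: bound_constants_def)
    also have "\<dots> \<le> C * weight x"
      using C projective_norm_elementary[OF x] by (intro mult_left_mono) (auto simp: bound_constants_def)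
    finally show ?thesis .
  qed
  then show "C \<in> bound_constants (tuples n X) weight W (tensor_restrict S)"
    using C by (simp add: bound_constants_def tensor_restrict_def)
qed

lemma linearization_exists:
  fixes W :: "('k, 'w) normed_module"
  assumes W: "seminormed_space W" and T: "T \<in> multilinear_maps n X W"
  shows "\<exists>S\<in>linear_maps projective W. tensor_restrict S = T"
proof -
  interpret W: seminormed_space W by fact
  interpret tensor_multilinear n X W T by unfold_locales (fact T)
  have "tensor_restrict linearization = T"
  proof (rule PiE_ext)
    show "T \<in> tuples n X \<rightarrow>\<^sub>E carrier W" using T by (simp add: multilinear_maps_def)
    show "tensor_restrict linearization \<in> tuples n X \<rightarrow>\<^sub>E carrier W"
      by (simp add: tensor_restrict_def linearization_closed elementary_closed)
  qed (simp add: tensor_restrict_def linearization_elementary)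
  then show ?thesis using linearization_linear by blast
qed

text \<open>The isomorphism evaluates at elementary tensors: injective since they span, surjective
  since every multilinear map has a linearization. Equality of the constants shows both that bounded
  maps correspond to bounded maps and that norms agree.\<close>

lemma bounded_linear_projective_isomorphic:
  fixes W :: "('k, 'w) normed_module"
  assumes "banach_space W"
  shows "isometrically_isomorphic (bounded_linear_space projective W) (bounded_multilinear_space n X W)"
proof -
  interpret W: banach_space W by fact
  note W = W.seminormed_space_axioms
  let ?B = "bounded_linear_space projective W" and ?M = "bounded_multilinear_space n X W"
  let ?\<phi> = "restrict tensor_restrict (carrier ?B)"
  interpret B: banach_space ?B by (rule projective.banach_bounded_linear_space) fact
  note carriers = projective.carrier_bounded_linear_space carrier_bounded_multilinear_space
  have lin: "S \<in> linear_maps projective W" if "S \<in> carrier ?B" for S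
    using that unfolding carriers by blast
  have closed: "tensor_restrict S \<in> carrier ?M" if S: "S \<in> carrier ?B" for S
    using S tensor_restrict_multilinear[OF lin[OF S]] tensor_restrict_constants[OF W lin[OF S]]
    unfolding carriers by simp
  have "?\<phi> \<in> linear_maps ?B ?M"
  proof (rule linear_mapsI)
    show "?\<phi> (f \<oplus>\<^bsub>?B\<^esub> g) = ?\<phi> f \<oplus>\<^bsub>?M\<^esub> ?\<phi> g" if "f \<in> carrier ?B" "g \<in> carrier ?B" for f g
      using that B.M.a_closed[OF that]
      by (simp, simp add: bounded_linear_space_def bounded_multilinear_space_def tensor_restrict_def
          elementary_closed cong: restrict_cong)
    show "?\<phi> (c \<odot>\<^bsub>?B\<^esub> f) = c \<odot>\<^bsub>?M\<^esub> ?\<phi> f" if "f \<in> carrier ?B" for c f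
      using that B.smult_closed'[OF that, of c]
      by (simp, simp add: bounded_linear_space_def bounded_multilinear_space_def tensor_restrict_def
          elementary_closed cong: restrict_cong)
  qed (use closed in simp)
  moreover have "inj_on tensor_restrict (carrier ?B)"
  proof (rule inj_onI)
    fix S S' assume S: "S \<in> carrier ?B" and S': "S' \<in> carrier ?B"
      and eq: "tensor_restrict S = tensor_restrict S'"
    show "S = S'"
      by (rule linear_maps_projective_eqI[OF lin[OF S] lin[OF S'] W])
        (use fun_cong[OF eq] in \<open>simp add: tensor_restrict_def split: if_splits\<close>, metis restrict_apply)
  qed
  moreover have "\<exists>S\<in>carrier ?B. tensor_restrict S = T" if T: "T \<in> carrier ?M" for T
  proof -
    have "T \<in> multilinear_maps n X W" using T unfolding carriers by blast
    then obtain S where S: "S \<in> linear_maps projective W" "tensor_restrict S = T"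
      using linearization_exists[OF W] by blast
    then show ?thesis using T tensor_restrict_constants[OF W S(1)] unfolding carriers by auto
  qed
  then have "tensor_restrict ` carrier ?B = carrier ?M" using closed by blast
  ultimately have "bij_betw ?\<phi> (carrier ?B) (carrier ?M)"
    by (simp add: bij_betw_def)
  moreover have "\<parallel>?\<phi> S\<parallel>\<^bsub>?M\<^esub> = \<parallel>S\<parallel>\<^bsub>?B\<^esub>" if S: "S \<in> carrier ?B" for S
    using norm_bounded_multilinear_space[OF W closed[OF S]]
      projective.norm_bounded_linear_space[OF W S] tensor_restrict_constants[OF W lin[OF S]] S by simp
  ultimately show ?thesis using \<open>?\<phi> \<in> linear_maps ?B ?M\<close> unfolding isometrically_isomorphic_def by blast
qed

section \<open>Lipschitz constants on decomposable tensors\<close>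

lemma zero_decomposable: "\<zero>\<^bsub>tensor\<^esub> \<in> decomposable_tensors n X"
proof -
  obtain x where x: "x \<in> tuples n X" using tuples_nonempty by blast
  \<comment> \<open>Any tuple will do once its first component is multiplied by 0.\<close>
  have "\<zero>\<^bsub>tensor\<^esub> = elementary (x(1 := 0 \<odot>\<^bsub>X 1\<^esub> x 1))"
    using elementary_scale[OF x, of 0] tensor.smult_l_null[OF elementary_closed[OF x]] by simp
  moreover have "x(1 := 0 \<odot>\<^bsub>X 1\<^esub> x 1) \<in> tuples n X"
    using x n_pos by (simp add: tuples_upd component_smult tuples_component)
  ultimately show ?thesis by (simp add: decomposable_tensors_def)
qed

text \<open>Together with \<open>tensor_restrict_constants\<close>, three sets of constants
  coincide: those of the multilinear map, those of its linearization, and the Lipschitz constants of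
  the \<Sigma>-operator.\<close>

lemma lipschitz_constants_eq:
  fixes Y :: "('k, 'w) normed_module"
  assumes Y: "seminormed_space Y" and S: "S \<in> linear_maps projective Y"
  shows "lipschitz_constants n X Y (restrict S (decomposable_tensors n X)) =
    bound_constants (tuples n X) weight Y (tensor_restrict S)"
proof (intro equalityI subsetI)
  interpret Y: seminormed_space Y by fact
  note closed = linear_maps_closed[OF S, simplified]
  fix L assume L: "L \<in> lipschitz_constants n X Y (restrict S (decomposable_tensors n X))"
  have "\<parallel>S (elementary x)\<parallel>\<^bsub>Y\<^esub> \<le> L * weight x" if x: "x \<in> tuples n X" for x
  proof -
    have "elementary x \<in> decomposable_tensors n X" using x by (simp add: decomposable_tensors_def)
    then have "\<parallel>S (elementary x) \<ominus>\<^bsub>Y\<^esub> S \<zero>\<^bsub>tensor\<^esub>\<parallel>\<^bsub>Y\<^esub> \<le> L * d_pi n X (elementary x) \<zero>\<^bsub>tensor\<^esub>"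
      using L zero_decomposable by (auto simp: lipschitz_constants_def)
    then have "\<parallel>S (elementary x)\<parallel>\<^bsub>Y\<^esub> \<le> L * projective_norm n X (elementary x)"
      using projective.linear_map_zero[OF Y S] projective.minus_zero[of "elementary x"]
        elementary_closed[OF x] closed
      by (simp add: d_pi_def flip: projective_tensor_product_minus)
    also have "\<dots> \<le> L * weight x"
      using L projective_norm_elementary[OF x]
      by (intro mult_left_mono) (auto simp: lipschitz_constants_def)
    finally show ?thesis .
  qed
  then show "L \<in> bound_constants (tuples n X) weight Y (tensor_restrict S)"
    using L by (simp add: bound_constants_def lipschitz_constants_def tensor_restrict_def)
next
  fix C assume "C \<in> bound_constants (tuples n X) weight Y (tensor_restrict S)"
  \<comment> \<open>The bound is first moved to the whole tensor product, because the difference of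
    two decomposable tensors need not be decomposable.\<close>
  then have C: "C \<in> bound_constants (carrier projective) (vnorm projective) Y S"
    by (simp only: tensor_restrict_constants[OF Y S])
  have "\<parallel>S w \<ominus>\<^bsub>Y\<^esub> S z\<parallel>\<^bsub>Y\<^esub> \<le> C * d_pi n X w z"
    if "w \<in> decomposable_tensors n X" "z \<in> decomposable_tensors n X" for w z
  proof -
    have wz: "w \<in> carrier projective" "z \<in> carrier projective"
      using that by (auto simp: decomposable_tensors_def elementary_closed)
    then have "\<parallel>S (w \<ominus>\<^bsub>projective\<^esub> z)\<parallel>\<^bsub>Y\<^esub> \<le> C * \<parallel>w \<ominus>\<^bsub>projective\<^esub> z\<parallel>\<^bsub>projective\<^esub>"
      using C projective.M.minus_closed[OF wz] unfolding bound_constants_def by blast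
    then show ?thesis
      using projective.linear_map_minus[OF Y S wz] by (simp add: d_pi_def projective_tensor_product_minus)
  qed
  then show "C \<in> lipschitz_constants n X Y (restrict S (decomposable_tensors n X))"
    using C by (simp add: lipschitz_constants_def bound_constants_def)
qed

text \<open>The multilinear map in the definition can be eliminated: for any linear \<open>S\<close>
  the map \<open>tensor_restrict S\<close> is multilinear and fulfils the required identity.\<close>

lemma sigma_operators_eq:
  "sigma_operators n X Y = (\<lambda>S. restrict S (decomposable_tensors n X)) ` linear_maps projective Y"
proof (intro equalityI subsetI)
  fix f assume "f \<in> (\<lambda>S. restrict S (decomposable_tensors n X)) ` linear_maps projective Y"
  then obtain S where S: "S \<in> linear_maps projective Y" "f = restrict S (decomposable_tensors n X)"
    by blast
  have "\<forall>x\<in>tuples n X. S (elementary x) = tensor_restrict S x" by (simp add: tensor_restrict_def)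
  then show "f \<in> sigma_operators n X Y"
    using S tensor_restrict_multilinear[OF S(1)] unfolding sigma_operators_def by blast
qed (auto simp: sigma_operators_def)

text \<open>The map is exposed together with its value at zero, and goes from the multilinear side,
  because this is the form in which completeness is transported to the \<Sigma>-operators by
  \<open>banach_space_isometric_image\<close>.\<close>

lemma multilinear_sigma_isometry:
  fixes Y :: "('k, 'w) normed_module"
  assumes "banach_space Y"
  shows "\<exists>\<phi>\<in>linear_maps (bounded_multilinear_space n X Y) (lipschitz_sigma_space n X Y).
    bij_betw \<phi> (carrier (bounded_multilinear_space n X Y)) (carrier (lipschitz_sigma_space n X Y)) \<and>
    (\<forall>T\<in>carrier (bounded_multilinear_space n X Y).
      \<parallel>\<phi> T\<parallel>\<^bsub>lipschitz_sigma_space n X Y\<^esub> = \<parallel>T\<parallel>\<^bsub>bounded_multilinear_space n X Y\<^esub>) \<and>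
    \<phi> \<zero>\<^bsub>bounded_multilinear_space n X Y\<^esub> = \<zero>\<^bsub>lipschitz_sigma_space n X Y\<^esub>"
proof -
  interpret Y: banach_space Y by fact
  note Y = Y.seminormed_space_axioms
  let ?M = "bounded_multilinear_space n X Y" and ?L = "lipschitz_sigma_space n X Y"
  let ?D = "decomposable_tensors n X"
  interpret M: banach_space ?M by (rule banach_bounded_multilinear_space) fact
  \<comment> \<open>A linearization is picked for each \<open>T\<close> separately; linearity of
    \<phi> is later read off from values on elementary tensors, not from the way this choice is
    made.\<close>
  obtain lin where lin: "\<And>T. T \<in> multilinear_maps n X Y \<Longrightarrow>
      lin T \<in> linear_maps projective Y \<and> tensor_restrict (lin T) = T"
    using linearization_exists[OF Y] by metis
  have linM: "lin T \<in> linear_maps projective Y" "tensor_restrict (lin T) = T" if "T \<in> carrier ?M" for T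
    using lin[of T] that by (auto simp: carrier_bounded_multilinear_space)
  let ?\<phi> = "\<lambda>T\<in>carrier ?M. restrict (lin T) ?D"
  have \<phi>_elem: "?\<phi> T (elementary x) = T x" if T: "T \<in> carrier ?M" and x: "x \<in> tuples n X" for T x
    using fun_cong[OF linM(2)[OF T], of x] T x by (simp add: tensor_restrict_def decomposable_tensors_def)
  have constants: "lipschitz_constants n X Y (?\<phi> T) = bound_constants (tuples n X) weight Y T"
    if T: "T \<in> carrier ?M" for T
    using lipschitz_constants_eq[OF Y linM(1)[OF T]] linM(2)[OF T] T by simp
  have carrier_L: "carrier ?L = {f \<in> sigma_operators n X Y. lipschitz_constants n X Y f \<noteq> {}}"
    and norm_L: "\<And>f. \<parallel>f\<parallel>\<^bsub>?L\<^esub> = Inf (lipschitz_constants n X Y f)"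
    and add_L: "\<And>f g. f \<oplus>\<^bsub>?L\<^esub> g = (\<lambda>z\<in>?D. f z \<oplus>\<^bsub>Y\<^esub> g z)"
    and smult_L: "\<And>c f. c \<odot>\<^bsub>?L\<^esub> f = (\<lambda>z\<in>?D. c \<odot>\<^bsub>Y\<^esub> f z)"
    and zero_L: "\<zero>\<^bsub>?L\<^esub> = (\<lambda>z\<in>?D. \<zero>\<^bsub>Y\<^esub>)"
    by (simp_all add: lipschitz_sigma_space_def)
  have add_M: "\<And>f g. f \<oplus>\<^bsub>?M\<^esub> g = (\<lambda>x\<in>tuples n X. f x \<oplus>\<^bsub>Y\<^esub> g x)"
    and smult_M: "\<And>c f. c \<odot>\<^bsub>?M\<^esub> f = (\<lambda>x\<in>tuples n X. c \<odot>\<^bsub>Y\<^esub> f x)"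
    and zero_M: "\<zero>\<^bsub>?M\<^esub> = (\<lambda>x\<in>tuples n X. \<zero>\<^bsub>Y\<^esub>)"
    by (simp_all add: bounded_multilinear_space_def)
  have closed: "?\<phi> T \<in> carrier ?L" if T: "T \<in> carrier ?M" for T
    using linM(1)[OF T] constants[OF T] T
    by (auto simp: carrier_L sigma_operators_eq carrier_bounded_multilinear_space)
  \<comment> \<open>Decomposable tensors are exactly the elementary ones, so an identity for values
    of \<phi> need only be checked on tuples. Linearity, the value at zero and surjectivity all rest
    on this.\<close>
  have \<phi>_eqI: "?\<phi> T = (\<lambda>z\<in>?D. h z)"
    if "T \<in> carrier ?M" "\<And>x. x \<in> tuples n X \<Longrightarrow> T x = h (elementary x)" for T h
  proof (rule extensionalityI[of _ ?D])
    show "?\<phi> T \<in> extensional ?D" using that(1) by simp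
    fix z assume "z \<in> ?D"
    then obtain x where z: "z = elementary x" and x: "x \<in> tuples n X"
      by (auto simp: decomposable_tensors_def)
    show "?\<phi> T z = (\<lambda>z\<in>?D. h z) z"
      using \<phi>_elem[OF that(1) x] that(2)[OF x] \<open>z \<in> ?D\<close> by (simp add: z)
  qed simp
  have "?\<phi> \<in> linear_maps ?M ?L"
  proof (rule linear_mapsI)
    show "?\<phi> \<in> carrier ?M \<rightarrow>\<^sub>E carrier ?L" using closed by (intro PiE_I) simp_all
    show "?\<phi> (f \<oplus>\<^bsub>?M\<^esub> g) = ?\<phi> f \<oplus>\<^bsub>?L\<^esub> ?\<phi> g" if "f \<in> carrier ?M" "g \<in> carrier ?M" for f g
      unfolding add_L using \<phi>_elem that by (intro \<phi>_eqI M.M.a_closed) (simp_all add: add_M)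
    show "?\<phi> (c \<odot>\<^bsub>?M\<^esub> f) = c \<odot>\<^bsub>?L\<^esub> ?\<phi> f" if "f \<in> carrier ?M" for c f
      unfolding smult_L using \<phi>_elem that by (intro \<phi>_eqI M.smult_closed') (simp_all add: smult_M)
  qed
  moreover have "inj_on ?\<phi> (carrier ?M)"
  proof (rule inj_onI)
    fix T T' assume T: "T \<in> carrier ?M" and T': "T' \<in> carrier ?M" and eq: "?\<phi> T = ?\<phi> T'"
    show "T = T'"
    proof (rule PiE_ext)
      show "T \<in> tuples n X \<rightarrow>\<^sub>E carrier Y" "T' \<in> tuples n X \<rightarrow>\<^sub>E carrier Y"
        using T T' by (simp_all add: carrier_bounded_multilinear_space multilinear_maps_def)
      show "T x = T' x" if "x \<in> tuples n X" for x
        using \<phi>_elem[OF T that] \<phi>_elem[OF T' that] eq by simp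
    qed
  qed
  moreover have "\<exists>T\<in>carrier ?M. ?\<phi> T = f" if f: "f \<in> carrier ?L" for f
  proof -
    obtain S where S: "S \<in> linear_maps projective Y" "f = restrict S ?D"
      and "lipschitz_constants n X Y f \<noteq> {}"
      using f by (auto simp: carrier_L sigma_operators_eq)
    then have T: "tensor_restrict S \<in> carrier ?M"
      using lipschitz_constants_eq[OF Y S(1)] tensor_restrict_multilinear[OF S(1)]
      by (simp add: carrier_bounded_multilinear_space)
    have "?\<phi> (tensor_restrict S) = f"
      unfolding S(2) by (rule \<phi>_eqI[OF T]) (simp add: tensor_restrict_def)
    then show ?thesis using T by blast
  qed
  then have "?\<phi> ` carrier ?M = carrier ?L" using closed by blast
  moreover have "\<parallel>?\<phi> T\<parallel>\<^bsub>?L\<^esub> = \<parallel>T\<parallel>\<^bsub>?M\<^esub>" if T: "T \<in> carrier ?M" for T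
    using norm_bounded_multilinear_space[OF Y T] by (simp only: norm_L constants[OF T])
  moreover have "?\<phi> \<zero>\<^bsub>?M\<^esub> = \<zero>\<^bsub>?L\<^esub>"
    unfolding zero_L by (rule \<phi>_eqI[OF M.M.zero_closed]) (simp add: zero_M)
  ultimately show ?thesis unfolding bij_betw_def by blast
qed

end

theorem proposition3p3:
  fixes X :: "nat \<Rightarrow> ('k::{real_normed_field, banach}, 'a) normed_module"
    and Y :: "('k, 'b) normed_module"
    and n :: nat
  assumes "n \<ge> 1"
    and "\<And>i. i \<in> {1..n} \<Longrightarrow> banach_space (X i)"
    and "banach_space Y"
  shows "banach_space (lipschitz_sigma_space n X Y) \<and>
    isometrically_isomorphic (lipschitz_sigma_space n X Y) (bounded_multilinear_space n X Y) \<and>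
    isometrically_isomorphic (lipschitz_sigma_space n X Y)
      (bounded_linear_space (completion (projective_tensor_product n X)) Y)"
proof -
  have "seminormed_space (X i)" if "i \<in> {1..n}" for i
  proof -
    interpret banach_space "X i" using that by (rule assms(2))
    show ?thesis by (rule seminormed_space_axioms)
  qed
  then interpret tensor_family n X using assms(1) by (intro tensor_family.intro)
  let ?M = "bounded_multilinear_space n X Y" and ?L = "lipschitz_sigma_space n X Y"
  let ?B = "bounded_linear_space projective Y"
  let ?C = "bounded_linear_space (completion projective) Y"
  have banach_M: "banach_space ?M" by (rule banach_bounded_multilinear_space) fact
  have banach_B: "banach_space ?B" by (rule projective.banach_bounded_linear_space) fact
  have banach_C: "banach_space ?C"
    by (rule seminormed_space.banach_bounded_linear_space[OF projective.seminormed_completion]) fact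
  have closed: "closed_under_operations V" if "banach_space V" for V :: "('k, 'v) normed_module"
  proof -
    interpret banach_space V by fact
    show ?thesis by (rule closed_under_operations)
  qed
  obtain \<phi> where \<phi>: "\<phi> \<in> linear_maps ?M ?L" "bij_betw \<phi> (carrier ?M) (carrier ?L)"
      "\<And>T. T \<in> carrier ?M \<Longrightarrow> \<parallel>\<phi> T\<parallel>\<^bsub>?L\<^esub> = \<parallel>T\<parallel>\<^bsub>?M\<^esub>" "\<phi> \<zero>\<^bsub>?M\<^esub> = \<zero>\<^bsub>?L\<^esub>"
    using multilinear_sigma_isometry[OF assms(3)] by blast
  have banach_L: "banach_space ?L"
    using banach_M \<phi>(1,2) by (rule banach_space_isometric_image) (simp_all add: \<phi>(3,4))
  have "isometrically_isomorphic ?M ?L"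
    using \<phi> unfolding isometrically_isomorphic_def by blast
  then have L_M: "isometrically_isomorphic ?L ?M"
    by (rule isometrically_isomorphic_sym[OF _ closed[OF banach_M]])
  \<comment> \<open>The intermediate space is \<open>?B\<close>, the bounded linear maps on the
    tensor product before completion.\<close>
  have "isometrically_isomorphic ?C ?M"
    using bounded_linear_projective_isomorphic[OF assms(3)] closed[OF banach_C]
    by (rule isometrically_isomorphic_trans[OF projective.bounded_linear_completion_isomorphic[OF assms(3)]])
  then have "isometrically_isomorphic ?M ?C"
    by (rule isometrically_isomorphic_sym[OF _ closed[OF banach_C]])
  with L_M have "isometrically_isomorphic ?L ?C"
    by (rule isometrically_isomorphic_trans[OF _ _ closed[OF banach_L]])
  then show ?thesis using banach_L L_M by blast
qed

end
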